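(* Let $G$ and $G'$ be countable directed graphs. There exists an algebra isomorphism $\tau:\mathfrak{L}_G\to\mathfrak{L}_{G'}$ which is bicontinuous for the weak-$*$ topologies if and only if $G$ and $G'$ are isomorphic as graphs.
   Context: A countable directed graph $G$ has countable vertex set $\mathcal{V}(G)$, edge set $\mathcal{E}(G)$, range and source maps $r,s$; graph isomorphism means bijections of vertices and edges intertwining $r$ and $s$. The free semigroupoid $\mathbb{F}^+(G)$ consists of vertices and finite paths $w=e_k\cdots e_1$ with $s(e_i)=r(e_{i-1})$, $s(w)=s(e_1)$, $r(w)=r(e_k)$. On $\mathcal{H}_G=\ell^2(\mathbb{F}^+(G))$ with orthonormal basis $\{\xi_w\}$, $L_e\xi_w=\xi_{ew}$ if $s(e)=r(w)$ and $0$ otherwise, and $P_v$ is the projection onto $\overline{\operatorname{span}}\{\xi_w:r(w)=v\}$. The tensor algebra $\mathcal{T}_+(G)$ is the norm-closed algebra generated by all $L_e$, $P_v$, and the free semigroupoid algebra $\mathfrak{L}_G$ is its weak operator topology closure in $B(\mathcal{H}_G)$. *)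

theory Defs
  imports "HOL-Analysis.Analysis"
begin

definition countable_graph :: "'v set \<Rightarrow> 'e set \<Rightarrow> ('e \<Rightarrow> 'v) \<Rightarrow> ('e \<Rightarrow> 'v) \<Rightarrow> bool" where
  "countable_graph V E r s \<longleftrightarrow> countable V \<and> countable E \<and> r ` E \<subseteq> V \<and> s ` E \<subseteq> V"

definition graph_iso ::
  "'v set \<Rightarrow> 'e set \<Rightarrow> ('e \<Rightarrow> 'v) \<Rightarrow> ('e \<Rightarrow> 'v) \<Rightarrow>
   'w set \<Rightarrow> 'f set \<Rightarrow> ('f \<Rightarrow> 'w) \<Rightarrow> ('f \<Rightarrow> 'w) \<Rightarrow> bool" where
  "graph_iso V E r s V' E' r' s' \<longleftrightarrow>
     (\<exists>\<phi> \<psi>. bij_betw \<phi> V V' \<and> bij_betw \<psi> E E' \<and>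
        (\<forall>e\<in>E. r' (\<psi> e) = \<phi> (r e) \<and> s' (\<psi> e) = \<phi> (s e)))"

text \<open>An element of the free semigroupoid is encoded as a pair (v, es): es = [] encodes the
  vertex v; a nonempty list es = [e_k, ..., e_1] encodes the path e_k...e_1, and then
  v = r(e_k) is its range.  Thus the first component is always the range r(w).\<close>

definition fsg :: "'v set \<Rightarrow> 'e set \<Rightarrow> ('e \<Rightarrow> 'v) \<Rightarrow> ('e \<Rightarrow> 'v) \<Rightarrow> ('v \<times> 'e list) set" where
  "fsg V E r s = {(v, es). v \<in> V \<and> set es \<subseteq> E \<and> (es \<noteq> [] \<longrightarrow> r (hd es) = v) \<and>
      (\<forall>i. Suc i < length es \<longrightarrow> s (es ! i) = r (es ! Suc i))}"

definition ell2 :: "'p set \<Rightarrow> ('p \<Rightarrow> complex) set" where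
  "ell2 P = {x. (\<forall>p. p \<notin> P \<longrightarrow> x p = 0) \<and> (\<lambda>p. (cmod (x p))\<^sup>2) summable_on UNIV}"

definition hnorm :: "('p \<Rightarrow> complex) \<Rightarrow> real" where
  "hnorm x = sqrt (infsum (\<lambda>p. (cmod (x p))\<^sup>2) UNIV)"

definition iprod :: "('p \<Rightarrow> complex) \<Rightarrow> ('p \<Rightarrow> complex) \<Rightarrow> complex" where
  "iprod x y = infsum (\<lambda>p. x p * cnj (y p)) UNIV"

text \<open>Bounded operators on the Hilbert space H, represented extensionally
  (an operator is a map on functions which vanishes outside H).\<close>

definition bop :: "('p \<Rightarrow> complex) set \<Rightarrow> (('p \<Rightarrow> complex) \<Rightarrow> ('p \<Rightarrow> complex)) set" where
  "bop H = {T. (\<forall>x\<in>H. T x \<in> H) \<and>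
     (\<forall>x\<in>H. \<forall>y\<in>H. \<forall>a b. T (\<lambda>p. a * x p + b * y p) = (\<lambda>p. a * T x p + b * T y p)) \<and>
     (\<exists>C. \<forall>x\<in>H. hnorm (T x) \<le> C * hnorm x) \<and>
     (\<forall>x. x \<notin> H \<longrightarrow> T x = (\<lambda>p. 0))}"

definition opnorm :: "('p \<Rightarrow> complex) set \<Rightarrow> (('p \<Rightarrow> complex) \<Rightarrow> ('p \<Rightarrow> complex)) \<Rightarrow> real" where
  "opnorm H T = Sup ((\<lambda>x. hnorm (T x)) ` {x\<in>H. hnorm x \<le> 1})"

definition op_add where "op_add A B = (\<lambda>x p. A x p + B x p)"
definition op_scale where "op_scale c A = (\<lambda>x p. c * A x p)"

definition norm_top :: "('p \<Rightarrow> complex) set \<Rightarrow> (('p \<Rightarrow> complex) \<Rightarrow> ('p \<Rightarrow> complex)) topology" where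
  "norm_top H = topology_generated_by
     {{S. opnorm H (\<lambda>x p. S x p - T x p) < e} | T e. True}"

definition wot :: "('p \<Rightarrow> complex) set \<Rightarrow> (('p \<Rightarrow> complex) \<Rightarrow> ('p \<Rightarrow> complex)) topology" where
  "wot H = topology_generated_by
     {{S. iprod (S x) y \<in> U} | x y U. x \<in> H \<and> y \<in> H \<and> open U}"

definition sigma_weak_fun ::
  "(nat \<Rightarrow> ('p \<Rightarrow> complex)) \<Rightarrow> (nat \<Rightarrow> ('p \<Rightarrow> complex)) \<Rightarrow>
   (('p \<Rightarrow> complex) \<Rightarrow> ('p \<Rightarrow> complex)) \<Rightarrow> complex" where
  "sigma_weak_fun xs ys S = infsum (\<lambda>n. iprod (S (xs n)) (ys n)) UNIV"

definition weak_star_top :: "('p \<Rightarrow> complex) set \<Rightarrow> (('p \<Rightarrow> complex) \<Rightarrow> ('p \<Rightarrow> complex)) topology" where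
  "weak_star_top H = topology_generated_by
     {{S. sigma_weak_fun xs ys S \<in> U} | xs ys U.
        (\<forall>n. xs n \<in> H \<and> ys n \<in> H) \<and>
        (\<lambda>n. (hnorm (xs n))\<^sup>2) summable_on UNIV \<and>
        (\<lambda>n. (hnorm (ys n))\<^sup>2) summable_on UNIV \<and> open U}"

inductive_set alg_gen :: "(('p \<Rightarrow> complex) \<Rightarrow> ('p \<Rightarrow> complex)) set \<Rightarrow>
    (('p \<Rightarrow> complex) \<Rightarrow> ('p \<Rightarrow> complex)) set" for Gs where
  gen: "A \<in> Gs \<Longrightarrow> A \<in> alg_gen Gs"
| add: "A \<in> alg_gen Gs \<Longrightarrow> B \<in> alg_gen Gs \<Longrightarrow> op_add A B \<in> alg_gen Gs"
| scale: "A \<in> alg_gen Gs \<Longrightarrow> op_scale c A \<in> alg_gen Gs"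
| mult: "A \<in> alg_gen Gs \<Longrightarrow> B \<in> alg_gen Gs \<Longrightarrow> A \<circ> B \<in> alg_gen Gs"

definition HG :: "'v set \<Rightarrow> 'e set \<Rightarrow> ('e \<Rightarrow> 'v) \<Rightarrow> ('e \<Rightarrow> 'v) \<Rightarrow> ('v \<times> 'e list \<Rightarrow> complex) set" where
  "HG V E r s = ell2 (fsg V E r s)"

text \<open>L_e xi_w = xi_{ew} if s(e) = r(w), and 0 otherwise.\<close>
definition Lop :: "'v set \<Rightarrow> 'e set \<Rightarrow> ('e \<Rightarrow> 'v) \<Rightarrow> ('e \<Rightarrow> 'v) \<Rightarrow> 'e \<Rightarrow>
    ('v \<times> 'e list \<Rightarrow> complex) \<Rightarrow> ('v \<times> 'e list \<Rightarrow> complex)" where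
  "Lop V E r s e x = (if x \<in> HG V E r s then
      (\<lambda>(v, es). if es \<noteq> [] \<and> hd es = e \<and> v = r e then x (s e, tl es) else 0)
    else (\<lambda>p. 0))"

definition Pop :: "'v set \<Rightarrow> 'e set \<Rightarrow> ('e \<Rightarrow> 'v) \<Rightarrow> ('e \<Rightarrow> 'v) \<Rightarrow> 'v \<Rightarrow>
    ('v \<times> 'e list \<Rightarrow> complex) \<Rightarrow> ('v \<times> 'e list \<Rightarrow> complex)" where
  "Pop V E r s v x = (if x \<in> HG V E r s then (\<lambda>(u, es). if u = v then x (u, es) else 0)
    else (\<lambda>p. 0))"

definition tensor_alg where
  "tensor_alg V E r s =
     (subtopology (norm_top (HG V E r s)) (bop (HG V E r s))) closure_of
     (alg_gen (Lop V E r s ` E \<union> Pop V E r s ` V))"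

definition fsga where
  "fsga V E r s =
     (subtopology (wot (HG V E r s)) (bop (HG V E r s))) closure_of (tensor_alg V E r s)"

definition alg_iso :: "(('p \<Rightarrow> complex) \<Rightarrow> ('p \<Rightarrow> complex)) set \<Rightarrow>
    (('q \<Rightarrow> complex) \<Rightarrow> ('q \<Rightarrow> complex)) set \<Rightarrow>
    ((('p \<Rightarrow> complex) \<Rightarrow> ('p \<Rightarrow> complex)) \<Rightarrow> (('q \<Rightarrow> complex) \<Rightarrow> ('q \<Rightarrow> complex))) \<Rightarrow> bool" where
  "alg_iso A B \<tau> \<longleftrightarrow> bij_betw \<tau> A B \<and>
     (\<forall>X\<in>A. \<forall>Y\<in>A. \<tau> (op_add X Y) = op_add (\<tau> X) (\<tau> Y) \<and> \<tau> (X \<circ> Y) = \<tau> X \<circ> \<tau> Y) \<and>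
     (\<forall>X\<in>A. \<forall>c. \<tau> (op_scale c X) = op_scale c (\<tau> X))"

end

theory Submission
  imports Defs
begin

text \<open>
  An operator in the free semigroupoid algebra acts as convolution with its coefficient function
  \<open>w \<mapsto> \<langle>T \<xi>\<^bsub>s(w)\<^esub>, \<xi>\<^sub>w\<rangle>\<close> on paths. Conversely, every bounded convolution operator is the
  weak-* limit of its Fejer means with respect to a weight on edges for which only finitely many
  edge words have bounded weight; so the algebra consists exactly of the bounded
  convolution operators, and a weak-* continuous functional is controlled by its values on path
  operators.

  A weak-* continuous character takes the value 1 at exactly one vertex projection \<open>P\<^sub>v\<close>, and all
  characters at \<open>v\<close> agree on idempotents, because the coefficients of an idempotent on nonempty words
  in the loops at \<open>v\<close> vanish. Transporting the characters \<open>T \<mapsto> \<langle>T \<xi>\<^sub>v, \<xi>\<^sub>v\<rangle>\<close> along the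
  isomorphism therefore gives a bijection of the vertices. The coefficient functionals of the edges
  from \<open>v\<close> to \<open>w\<close> are linearly independent derivations relative to two such characters; modulo inner
  ones, the transported derivations are determined by their values on the edges between the
  corresponding vertices of the other graph, which compares the numbers of edges.

  In the other direction, a graph isomorphism induces a unitary that conjugates one algebra onto
  the other.
\<close>

subsection \<open>Square-summable families\<close>

text \<open>Two obstacles shape the argument. With infinitely many edges, Fejer means graded by path
  length would be infinite sums instead of polynomials. Their boundedness rests only on the grading
  being additive under concatenation, so the length may be exchanged for a weight built from an
  enumeration of the edges. Boundedness in turn upgrades coordinatewise convergence to weak-*
  convergence, the form in which functionals can be evaluated.

  Secondly, an isomorphism need not carry vertex characters to vertex characters, since a vertex
  with loops can carry many characters. A transported character is therefore located only up to its
  vertex, and the later facts are stated for arbitrary characters there. Idempotents detect the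
  vertex and are blind to the choice of character. A derivation relative to characters at v and w is
  still governed by the edges from v to w; if v and w differ, its value at the projection of v is
  one further free scalar, which is exactly what a multiple of \<open>\<eta>' - \<eta>\<close>
  removes.\<close>

lemma ell2_zero [simp]: "(\<lambda>p. 0) \<in> ell2 P"
  by (simp add: ell2_def)

lemma ell2_summable: "x \<in> ell2 P \<Longrightarrow> (\<lambda>p. (cmod (x p))\<^sup>2) summable_on UNIV"
  by (simp add: ell2_def)

lemma ell2_outside: "x \<in> ell2 P \<Longrightarrow> p \<notin> P \<Longrightarrow> x p = 0"
  by (simp add: ell2_def)

lemma hnorm_nonneg [simp]: "0 \<le> hnorm x"
  by (simp add: hnorm_def infsum_nonneg)

lemma hnorm_zero [simp]: "hnorm (\<lambda>p. 0) = 0"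
  by (simp add: hnorm_def)

lemma hnorm_power2: "(hnorm x)\<^sup>2 = infsum (\<lambda>p. (cmod (x p))\<^sup>2) UNIV"
  by (simp add: hnorm_def infsum_nonneg)

lemma sum_le_hnorm_power2:
  assumes "x \<in> ell2 P" "finite W"
  shows "(\<Sum>p\<in>W. (cmod (x p))\<^sup>2) \<le> (hnorm x)\<^sup>2"
  unfolding hnorm_power2 using assms by (intro finite_sum_le_infsum) (auto simp: ell2_def)

lemma cmod_le_hnorm:
  assumes "x \<in> ell2 P"
  shows "cmod (x p) \<le> hnorm x"
proof (rule power2_le_imp_le)
  show "(cmod (x p))\<^sup>2 \<le> (hnorm x)\<^sup>2" using sum_le_hnorm_power2[OF assms, of "{p}"] by simp
qed simp

lemma hnorm_boundI:
  assumes "\<And>W. finite W \<Longrightarrow> (\<Sum>p\<in>W. (cmod (x p))\<^sup>2) \<le> B\<^sup>2" "0 \<le> B"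
  shows "(\<lambda>p. (cmod (x p))\<^sup>2) summable_on UNIV" "hnorm x \<le> B"
proof -
  show s: "(\<lambda>p. (cmod (x p))\<^sup>2) summable_on UNIV"
    by (rule nonneg_bdd_above_summable_on) (auto intro!: bdd_aboveI[of _ "B\<^sup>2"] assms)
  have "(hnorm x)\<^sup>2 \<le> B\<^sup>2"
    unfolding hnorm_power2 by (rule infsum_le_finite_sums[OF s]) (use assms in auto)
  then show "hnorm x \<le> B"
    using assms(2) by (rule power2_le_imp_le)
qed

lemma cmod_lincomb_power2_le:
  "(cmod (a * x + b * y))\<^sup>2 \<le> 2 * (cmod a)\<^sup>2 * (cmod x)\<^sup>2 + 2 * (cmod b)\<^sup>2 * (cmod y)\<^sup>2"
proof -
  have "(cmod (a * x + b * y))\<^sup>2 \<le> (cmod (a * x) + cmod (b * y))\<^sup>2"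
    by (intro power_mono norm_triangle_ineq) auto
  also have "\<dots> \<le> 2 * (cmod (a * x))\<^sup>2 + 2 * (cmod (b * y))\<^sup>2"
    using sum_squares_bound[of "cmod (a * x)" "cmod (b * y)"] by (simp add: power2_sum)
  finally show ?thesis by (simp add: norm_mult power_mult_distrib)
qed

lemma ell2_lincomb:
  assumes "x \<in> ell2 P" "y \<in> ell2 P"
  shows "(\<lambda>p. a * x p + b * y p) \<in> ell2 P"
proof -
  have "(\<lambda>p. 2 * (cmod a)\<^sup>2 * (cmod (x p))\<^sup>2 + 2 * (cmod b)\<^sup>2 * (cmod (y p))\<^sup>2) summable_on UNIV"
    using assms by (intro summable_on_add summable_on_cmult_right) (auto simp: ell2_def)
  then have "(\<lambda>p. (cmod (a * x p + b * y p))\<^sup>2) summable_on UNIV"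
    by (rule summable_on_comparison_test) (auto intro: cmod_lincomb_power2_le)
  then show ?thesis using assms by (auto simp: ell2_def)
qed

lemma ell2_diff: "x \<in> ell2 P \<Longrightarrow> y \<in> ell2 P \<Longrightarrow> (\<lambda>p. x p - y p) \<in> ell2 P"
  using ell2_lincomb[of x P y 1 "-1"] by simp

lemma ell2_scale: "x \<in> ell2 P \<Longrightarrow> (\<lambda>p. c * x p) \<in> ell2 P"
  using ell2_lincomb[of x P x c 0] by simp

text \<open>Stands in for the triangle inequality: the pointwise estimate can be summed directly,
  and the lost factor 2 is harmless wherever just some bound is wanted.\<close>

lemma hnorm_lincomb_power2_le:
  assumes "x \<in> ell2 P" "y \<in> ell2 P"
  shows "(hnorm (\<lambda>p. a * x p + b * y p))\<^sup>2
    \<le> 2 * (cmod a)\<^sup>2 * (hnorm x)\<^sup>2 + 2 * (cmod b)\<^sup>2 * (hnorm y)\<^sup>2" (is "_ \<le> ?R")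
proof -
  have "hnorm (\<lambda>p. a * x p + b * y p) \<le> sqrt ?R"
  proof (rule hnorm_boundI(2))
    fix W :: "'a set" assume W: "finite W"
    have "(\<Sum>p\<in>W. (cmod (a * x p + b * y p))\<^sup>2)
        \<le> (\<Sum>p\<in>W. 2 * (cmod a)\<^sup>2 * (cmod (x p))\<^sup>2 + 2 * (cmod b)\<^sup>2 * (cmod (y p))\<^sup>2)"
      by (intro sum_mono cmod_lincomb_power2_le)
    also have "\<dots> = 2 * (cmod a)\<^sup>2 * (\<Sum>p\<in>W. (cmod (x p))\<^sup>2) + 2 * (cmod b)\<^sup>2 * (\<Sum>p\<in>W. (cmod (y p))\<^sup>2)"
      by (simp add: sum.distrib sum_distrib_left)
    also have "\<dots> \<le> ?R"
      using sum_le_hnorm_power2[OF _ W] assms by (intro add_mono mult_left_mono) auto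
    finally show "(\<Sum>p\<in>W. (cmod (a * x p + b * y p))\<^sup>2) \<le> (sqrt ?R)\<^sup>2"
      by simp
  qed simp
  then have "(hnorm (\<lambda>p. a * x p + b * y p))\<^sup>2 \<le> (sqrt ?R)\<^sup>2"
    by (intro power_mono) auto
  then show ?thesis by simp
qed

lemma hnorm_scale: "hnorm (\<lambda>p. c * x p) = cmod c * hnorm x"
  by (simp add: hnorm_def norm_mult power_mult_distrib infsum_cmult_right' real_sqrt_mult)

text \<open>Coordinate projections (\<open>h = id\<close>), the shift performed by
  \<open>Lop\<close>, and unitaries that relabel a basis all have this shape, so one bound for
  injective \<open>h\<close> covers them.\<close>

definition cpull :: "'q set \<Rightarrow> ('q \<Rightarrow> 'p) \<Rightarrow> ('p \<Rightarrow> complex) \<Rightarrow> 'q \<Rightarrow> complex" where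
  "cpull A h x = (\<lambda>q. if q \<in> A then x (h q) else 0)"

lemma cpull_bound:
  assumes x: "x \<in> ell2 P" and h: "inj_on h A"
  shows "(\<lambda>q. (cmod (cpull A h x q))\<^sup>2) summable_on UNIV" "hnorm (cpull A h x) \<le> hnorm x"
proof -
  have *: "(\<Sum>q\<in>W. (cmod (cpull A h x q))\<^sup>2) \<le> (hnorm x)\<^sup>2" if W: "finite W" for W
  proof -
    have "(\<Sum>q\<in>W. (cmod (cpull A h x q))\<^sup>2) = (\<Sum>q\<in>W \<inter> A. (cmod (x (h q)))\<^sup>2)"
      using W by (intro sum.mono_neutral_cong_right) (auto simp: cpull_def)
    also have "\<dots> = (\<Sum>p\<in>h ` (W \<inter> A). (cmod (x p))\<^sup>2)"
      using h by (subst sum.reindex) (auto intro: inj_on_subset)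
    also have "\<dots> \<le> (hnorm x)\<^sup>2"
      using W by (intro sum_le_hnorm_power2[OF x]) auto
    finally show ?thesis .
  qed
  show "(\<lambda>q. (cmod (cpull A h x q))\<^sup>2) summable_on UNIV" "hnorm (cpull A h x) \<le> hnorm x"
    using hnorm_boundI[OF *] by auto
qed

lemma cpull_in_ell2:
  assumes "x \<in> ell2 P" "inj_on h A" "\<And>q. q \<in> A \<Longrightarrow> h q \<in> P \<Longrightarrow> q \<in> Q"
  shows "cpull A h x \<in> ell2 Q"
  using cpull_bound(1)[OF assms(1,2)] assms(1,3) by (auto simp: ell2_def cpull_def)

lemma cpull_lincomb:
  "cpull A h (\<lambda>p. a * x p + b * y p) = (\<lambda>q. a * cpull A h x q + b * cpull A h y q)"
  by (auto simp: cpull_def)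

definition xi :: "'p \<Rightarrow> 'p \<Rightarrow> complex" where
  "xi p = (\<lambda>q. if q = p then 1 else 0)"

lemma xi_apply: "xi p q = (if q = p then 1 else 0)"
  by (simp add: xi_def)

lemma xi_in_ell2 [simp]: "p \<in> P \<Longrightarrow> xi p \<in> ell2 P"
proof -
  assume p: "p \<in> P"
  have "(\<lambda>q. (cmod (xi p q))\<^sup>2) summable_on UNIV"
    by (rule summable_on_cong_neutral[where T = "{p}", THEN iffD2]) (auto simp: xi_def)
  then show ?thesis using p by (auto simp: ell2_def xi_def)
qed

section \<open>Inner products and weak convergence\<close>

lemma ell2_mult_summable:
  assumes x: "x \<in> ell2 P" and y: "y \<in> ell2 Q"
  shows "(\<lambda>p. cmod (x p * cnj (y p))) summable_on UNIV" "cmod (iprod x y) \<le> hnorm x * hnorm y"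
proof -
  have *: "(\<Sum>p\<in>W. cmod (x p * cnj (y p))) \<le> hnorm x * hnorm y" if W: "finite W" for W
  proof (rule power2_le_imp_le)
    have "(\<Sum>p\<in>W. cmod (x p * cnj (y p)))\<^sup>2 = (\<Sum>p\<in>W. cmod (x p) * cmod (y p))\<^sup>2"
      by (simp add: norm_mult)
    also have "\<dots> \<le> (\<Sum>p\<in>W. (cmod (x p))\<^sup>2) * (\<Sum>p\<in>W. (cmod (y p))\<^sup>2)"
      by (rule Cauchy_Schwarz_ineq_sum)
    also have "\<dots> \<le> (hnorm x)\<^sup>2 * (hnorm y)\<^sup>2"
      using sum_le_hnorm_power2[OF x W] sum_le_hnorm_power2[OF y W]
      by (intro mult_mono) (auto intro: sum_nonneg)
    finally show "(\<Sum>p\<in>W. cmod (x p * cnj (y p)))\<^sup>2 \<le> (hnorm x * hnorm y)\<^sup>2"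
      by (simp add: power_mult_distrib)
  qed auto
  show s: "(\<lambda>p. cmod (x p * cnj (y p))) summable_on UNIV"
    by (rule nonneg_bdd_above_summable_on) (use * in \<open>auto intro!: bdd_aboveI\<close>)
  have "cmod (iprod x y) \<le> infsum (\<lambda>p. cmod (x p * cnj (y p))) UNIV"
    unfolding iprod_def by (rule norm_infsum_bound[OF s])
  also have "\<dots> \<le> hnorm x * hnorm y"
    by (rule infsum_le_finite_sums[OF s]) (use * in auto)
  finally show "cmod (iprod x y) \<le> hnorm x * hnorm y" .
qed

lemmas ell2_mult_summable' = abs_summable_summable[OF ell2_mult_summable(1)]

lemma iprod_diff_left:
  assumes "x \<in> ell2 P" "z \<in> ell2 P" "y \<in> ell2 P"
  shows "iprod (\<lambda>p. x p - z p) y = iprod x y - iprod z y"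
  using infsum_add[OF ell2_mult_summable'[OF assms(1,3)] ell2_mult_summable'[OF ell2_scale[OF assms(2), of "-1"] assms(3)]]
  by (simp add: iprod_def left_diff_distrib infsum_uminus)

lemma iprod_finite_right:
  assumes "finite F" "\<And>p. p \<notin> F \<Longrightarrow> y p = 0"
  shows "iprod x y = (\<Sum>p\<in>F. x p * cnj (y p))"
  unfolding iprod_def
  by (rule infsumI, rule has_sum_finite_neutralI) (use assms in auto)

lemma iprod_xi: "iprod x (xi p) = x p"
  using iprod_finite_right[of "{p}" "xi p" x] by (simp add: xi_def)

lemma iprod_zero [simp]: "iprod x (\<lambda>p. 0) = 0" "iprod (\<lambda>p. 0) y = 0"
  by (simp_all add: iprod_def)

lemma ell2_tail_small:
  assumes y: "y \<in> ell2 P" and "0 < e"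
  obtains F where "finite F" "hnorm (cpull (- F) id y) \<le> e"
proof -
  have "0 < e\<^sup>2" using assms by simp
  then obtain F where F: "finite F"
    "dist (\<Sum>p\<in>F. (cmod (y p))\<^sup>2) (infsum (\<lambda>p. (cmod (y p))\<^sup>2) UNIV) \<le> e\<^sup>2"
    using infsum_finite_approximation[OF ell2_summable[OF y]] by blast
  have "hnorm (cpull (- F) id y) \<le> e"
  proof (rule hnorm_boundI(2))
    fix W :: "'a set" assume W: "finite W"
    have "(\<Sum>p\<in>W. (cmod (cpull (- F) id y p))\<^sup>2) = (\<Sum>p\<in>W - F. (cmod (y p))\<^sup>2)"
      using W by (intro sum.mono_neutral_cong_right) (auto simp: cpull_def)
    also have "\<dots> = (\<Sum>p\<in>(W - F) \<union> F. (cmod (y p))\<^sup>2) - (\<Sum>p\<in>F. (cmod (y p))\<^sup>2)"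
      using W F by (subst sum.union_disjoint) auto
    also have "\<dots> \<le> (hnorm y)\<^sup>2 - (\<Sum>p\<in>F. (cmod (y p))\<^sup>2)"
      using W F by (intro diff_right_mono sum_le_hnorm_power2[OF y]) auto
    also have "\<dots> \<le> e\<^sup>2" using F(2) by (auto simp: hnorm_power2 dist_real_def)
    finally show "(\<Sum>p\<in>W. (cmod (cpull (- F) id y p))\<^sup>2) \<le> e\<^sup>2" .
  qed (use assms in auto)
  then show thesis using that F(1) by blast
qed

text \<open>Cut \<open>y\<close> into finitely many coordinates and a small tail: pointwise
  convergence handles the former, the uniform bound with Cauchy-Schwarz the latter.\<close>

lemma iprod_tendsto_zero:
  assumes d: "\<And>n. d n \<in> ell2 P" "\<And>n. hnorm (d n) \<le> B" "\<And>p. (\<lambda>n. d n p) \<longlonglongrightarrow> 0"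
    and y: "y \<in> ell2 P"
  shows "(\<lambda>n. iprod (d n) y) \<longlonglongrightarrow> 0"
proof (rule LIMSEQ_I)
  fix e :: real assume e: "0 < e"
  have B: "0 \<le> B" using d(2)[of 0] hnorm_nonneg[of "d 0"] by linarith
  \<comment> \<open>\<open>B\<close> may be 0, hence the denominator uses
    \<open>B + 1\<close>.\<close>
  obtain F where F: "finite F" "hnorm (cpull (- F) id y) \<le> e / (2 * (B + 1))"
    using ell2_tail_small[OF y, of "e / (2 * (B + 1))"] e B by auto
  have yF: "cpull (- F) id y \<in> ell2 P" by (rule cpull_in_ell2[OF y]) auto
  have split: "iprod (d n) y = (\<Sum>p\<in>F. d n p * cnj (y p)) + iprod (d n) (cpull (- F) id y)" for n
  proof -
    have yF': "cpull F id y \<in> ell2 P" by (rule cpull_in_ell2[OF y]) auto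
    have "iprod (d n) y = infsum (\<lambda>p. d n p * cnj (cpull F id y p) + d n p * cnj (cpull (- F) id y p)) UNIV"
      unfolding iprod_def by (rule infsum_cong) (auto simp: cpull_def)
    also have "\<dots> = iprod (d n) (cpull F id y) + iprod (d n) (cpull (- F) id y)"
      unfolding iprod_def by (rule infsum_add) (rule ell2_mult_summable'[OF d(1)], fact)+
    also have "iprod (d n) (cpull F id y) = (\<Sum>p\<in>F. d n p * cnj (cpull F id y p))"
      by (rule iprod_finite_right[OF F(1)]) (auto simp: cpull_def)
    also have "\<dots> = (\<Sum>p\<in>F. d n p * cnj (y p))" by (simp add: cpull_def)
    finally show ?thesis .
  qed
  have "(\<lambda>n. \<Sum>p\<in>F. d n p * cnj (y p)) \<longlonglongrightarrow> (\<Sum>p\<in>F. 0 * cnj (y p))"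
    by (intro tendsto_sum tendsto_mult d tendsto_const)
  then obtain N where N: "\<And>n. n \<ge> N \<Longrightarrow> cmod (\<Sum>p\<in>F. d n p * cnj (y p)) < e / 2"
    using LIMSEQ_D[of _ 0 "e/2"] e by auto
  show "\<exists>N. \<forall>n\<ge>N. norm (iprod (d n) y - 0) < e"
  proof (intro exI allI impI)
    fix n assume n: "N \<le> n"
    have "cmod (iprod (d n) (cpull (- F) id y)) \<le> hnorm (d n) * hnorm (cpull (- F) id y)"
      by (rule ell2_mult_summable(2)[OF d(1) yF])
    also have "\<dots> \<le> B * (e / (2 * (B + 1)))"
      using d(2) F(2) B by (intro mult_mono) auto
    also have "\<dots> \<le> e / 2" using B e by (simp add: field_simps)
    finally show "norm (iprod (d n) y - 0) < e"
      using N[OF n] unfolding split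
      using norm_triangle_ineq[of "\<Sum>p\<in>F. d n p * cnj (y p)" "iprod (d n) (cpull (- F) id y)"]
      by simp
  qed
qed

lemma iprod_tendsto:
  assumes z: "\<And>n. z n \<in> ell2 P" "\<And>n. hnorm (z n) \<le> B" "\<And>p. (\<lambda>n. z n p) \<longlonglongrightarrow> t p"
    and t: "t \<in> ell2 P" and y: "y \<in> ell2 P"
  shows "(\<lambda>n. iprod (z n) y) \<longlonglongrightarrow> iprod t y"
proof -
  have "hnorm (\<lambda>p. z n p - t p) \<le> sqrt (2 * B\<^sup>2 + 2 * (hnorm t)\<^sup>2)" for n
  proof (rule real_le_rsqrt)
    have "(hnorm (\<lambda>p. z n p - t p))\<^sup>2 \<le> 2 * (hnorm (z n))\<^sup>2 + 2 * (hnorm t)\<^sup>2"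
      using hnorm_lincomb_power2_le[OF z(1)[of n] t, of 1 "-1"] by simp
    also have "\<dots> \<le> 2 * B\<^sup>2 + 2 * (hnorm t)\<^sup>2"
      using z(2)[of n] by (simp add: power_mono)
    finally show "(hnorm (\<lambda>p. z n p - t p))\<^sup>2 \<le> 2 * B\<^sup>2 + 2 * (hnorm t)\<^sup>2" .
  qed
  then have "(\<lambda>n. iprod (\<lambda>p. z n p - t p) y) \<longlonglongrightarrow> 0"
    by (rule iprod_tendsto_zero[OF ell2_diff[OF z(1) t] _ LIM_zero[OF z(3)] y])
  then show ?thesis
    by (simp add: iprod_diff_left[OF z(1) t y] LIM_zero_iff)
qed

subsection \<open>Bounded operators\<close>

lemma bop_in: "T \<in> bop H \<Longrightarrow> x \<in> H \<Longrightarrow> T x \<in> H"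
  by (simp add: bop_def)

lemma bop_lincomb:
  "T \<in> bop H \<Longrightarrow> x \<in> H \<Longrightarrow> y \<in> H \<Longrightarrow>
    T (\<lambda>p. a * x p + b * y p) = (\<lambda>p. a * T x p + b * T y p)"
  by (simp add: bop_def)

lemma bop_scale:
  assumes "T \<in> bop H" "x \<in> H"
  shows "T (\<lambda>p. c * x p) = (\<lambda>p. c * T x p)"
  using bop_lincomb[OF assms(1,2,2), of c 0] by simp

lemma bop_zero: "T \<in> bop (ell2 P) \<Longrightarrow> T (\<lambda>p. 0) = (\<lambda>p. 0)"
  using bop_scale[of T "ell2 P" "\<lambda>p. 0" 0] by simp

lemma bop_outside: "T \<in> bop H \<Longrightarrow> x \<notin> H \<Longrightarrow> T x = (\<lambda>p. 0)"
  by (simp add: bop_def)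

lemma bop_bound:
  assumes "T \<in> bop H"
  obtains C where "0 \<le> C" "\<And>x. x \<in> H \<Longrightarrow> hnorm (T x) \<le> C * hnorm x"
proof -
  obtain C where C: "\<And>x. x \<in> H \<Longrightarrow> hnorm (T x) \<le> C * hnorm x"
    using assms unfolding bop_def by blast
  have "hnorm (T x) \<le> max C 0 * hnorm x" if "x \<in> H" for x
    using C[OF that] mult_right_mono[of C "max C 0" "hnorm x"] by simp
  then show thesis using that[of "max C 0"] by simp
qed

lemma bopI:
  assumes "\<And>x. x \<in> H \<Longrightarrow> T x \<in> H"
    "\<And>x y a b. x \<in> H \<Longrightarrow> y \<in> H \<Longrightarrow> T (\<lambda>p. a * x p + b * y p) = (\<lambda>p. a * T x p + b * T y p)"
    "\<And>x. x \<in> H \<Longrightarrow> hnorm (T x) \<le> C * hnorm x"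
    "\<And>x. x \<notin> H \<Longrightarrow> T x = (\<lambda>p. 0)"
  shows "T \<in> bop H"
  using assms unfolding bop_def by blast

lemma bop_lincomb_op:
  assumes "S \<in> bop (ell2 P)" "T \<in> bop (ell2 P)"
  shows "(\<lambda>x p. a * S x p + b * T x p) \<in> bop (ell2 P)"
proof -
  obtain C where C: "0 \<le> C" "\<And>x. x \<in> ell2 P \<Longrightarrow> hnorm (S x) \<le> C * hnorm x"
    using bop_bound[OF assms(1)] by blast
  obtain D where D: "0 \<le> D" "\<And>x. x \<in> ell2 P \<Longrightarrow> hnorm (T x) \<le> D * hnorm x"
    using bop_bound[OF assms(2)] by blast
  let ?K = "sqrt (2 * (cmod a)\<^sup>2 * C\<^sup>2 + 2 * (cmod b)\<^sup>2 * D\<^sup>2)"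
  show ?thesis
  proof (rule bopI[where C = ?K])
    fix x assume x: "x \<in> ell2 P"
    show "(\<lambda>p. a * S x p + b * T x p) \<in> ell2 P"
      by (intro ell2_lincomb bop_in[OF assms(1)] bop_in[OF assms(2)] x)
    show "hnorm (\<lambda>p. a * S x p + b * T x p) \<le> ?K * hnorm x"
    proof (rule power2_le_imp_le)
      have "(hnorm (\<lambda>p. a * S x p + b * T x p))\<^sup>2
          \<le> 2 * (cmod a)\<^sup>2 * (hnorm (S x))\<^sup>2 + 2 * (cmod b)\<^sup>2 * (hnorm (T x))\<^sup>2"
        by (rule hnorm_lincomb_power2_le[OF bop_in[OF assms(1) x] bop_in[OF assms(2) x]])
      also have "\<dots> \<le> 2 * (cmod a)\<^sup>2 * (C * hnorm x)\<^sup>2 + 2 * (cmod b)\<^sup>2 * (D * hnorm x)\<^sup>2"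
        using C(2)[OF x] D(2)[OF x] by (intro add_mono mult_left_mono power_mono) auto
      also have "\<dots> = (?K * hnorm x)\<^sup>2"
        by (simp add: power_mult_distrib algebra_simps)
      finally show "(hnorm (\<lambda>p. a * S x p + b * T x p))\<^sup>2 \<le> (?K * hnorm x)\<^sup>2" .
    qed simp
  next
    fix x y c d assume "x \<in> ell2 P" "y \<in> ell2 P"
    then show "(\<lambda>p. a * S (\<lambda>p. c * x p + d * y p) p + b * T (\<lambda>p. c * x p + d * y p) p) =
       (\<lambda>p. c * (a * S x p + b * T x p) + d * (a * S y p + b * T y p))"
      by (simp add: bop_lincomb[OF assms(1)] bop_lincomb[OF assms(2)] algebra_simps)
  qed (simp add: bop_outside[OF assms(1)] bop_outside[OF assms(2)])
qed

lemma bop_op_add: "S \<in> bop (ell2 P) \<Longrightarrow> T \<in> bop (ell2 P) \<Longrightarrow> op_add S T \<in> bop (ell2 P)"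
  using bop_lincomb_op[of S P T 1 1] by (simp add: op_add_def)

lemma bop_op_scale: "S \<in> bop (ell2 P) \<Longrightarrow> op_scale c S \<in> bop (ell2 P)"
  using bop_lincomb_op[of S P S c 0] by (simp add: op_scale_def)

lemma bop_comp:
  assumes S: "S \<in> bop (ell2 P)" and T: "T \<in> bop (ell2 P)"
  shows "S \<circ> T \<in> bop (ell2 P)"
proof -
  obtain C where C: "0 \<le> C" "\<And>x. x \<in> ell2 P \<Longrightarrow> hnorm (S x) \<le> C * hnorm x"
    using bop_bound[OF S] by blast
  obtain D where D: "0 \<le> D" "\<And>x. x \<in> ell2 P \<Longrightarrow> hnorm (T x) \<le> D * hnorm x"
    using bop_bound[OF T] by blast
  show ?thesis
  proof (rule bopI[where C = "C * D"])
    fix x assume x: "x \<in> ell2 P"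
    show "(S \<circ> T) x \<in> ell2 P" by (simp add: bop_in[OF S] bop_in[OF T] x)
    have "hnorm (S (T x)) \<le> C * (D * hnorm x)"
      using C(2)[OF bop_in[OF T x]] mult_left_mono[OF D(2)[OF x] C(1)] by linarith
    then show "hnorm ((S \<circ> T) x) \<le> C * D * hnorm x" by (simp add: mult.assoc)
  next
    fix x y a b assume "x \<in> ell2 P" "y \<in> ell2 P"
    then show "(S \<circ> T) (\<lambda>p. a * x p + b * y p) = (\<lambda>p. a * (S \<circ> T) x p + b * (S \<circ> T) y p)"
      by (simp add: bop_lincomb[OF S] bop_lincomb[OF T] bop_in[OF T])
  qed (simp add: bop_outside[OF T] bop_zero[OF S])
qed

lemma bop_ext:
  assumes "S \<in> bop (ell2 P)" "T \<in> bop (ell2 P)" "\<And>x p. x \<in> ell2 P \<Longrightarrow> p \<in> P \<Longrightarrow> S x p = T x p"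
  shows "S = T"
proof (intro ext)
  fix x p
  show "S x p = T x p"
  proof (cases "x \<in> ell2 P")
    case True
    then show ?thesis
      using assms(3) ell2_outside[OF bop_in[OF assms(1)]] ell2_outside[OF bop_in[OF assms(2)]]
      by (cases "p \<in> P") auto
  qed (simp add: bop_outside[OF assms(1)] bop_outside[OF assms(2)])
qed

lemma hnorm_le_opnorm:
  assumes D: "D \<in> bop (ell2 P)" and x: "x \<in> ell2 P"
  shows "hnorm (D x) \<le> opnorm (ell2 P) D * hnorm x"
proof (cases "hnorm x = 0")
  case True
  obtain C where "0 \<le> C" "\<And>x. x \<in> ell2 P \<Longrightarrow> hnorm (D x) \<le> C * hnorm x"
    using bop_bound[OF D] by blast
  then show ?thesis using True x by fastforce
next
  case False
  obtain C where C: "0 \<le> C" "\<And>x. x \<in> ell2 P \<Longrightarrow> hnorm (D x) \<le> C * hnorm x"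
    using bop_bound[OF D] by blast
  have pos: "hnorm x > 0" using False hnorm_nonneg[of x] by linarith
  let ?c = "complex_of_real (1 / hnorm x)"
  let ?y = "\<lambda>p. ?c * x p"
  have y: "?y \<in> ell2 P" by (rule ell2_scale[OF x])
  have ny: "hnorm ?y = 1" unfolding hnorm_scale using pos by (simp del: of_real_divide)
  have "hnorm (D ?y) \<le> opnorm (ell2 P) D"
    unfolding opnorm_def
  proof (rule cSup_upper)
    show "bdd_above ((\<lambda>x. hnorm (D x)) ` {x \<in> ell2 P. hnorm x \<le> 1})"
    proof (rule bdd_aboveI2)
      fix x assume "x \<in> {x \<in> ell2 P. hnorm x \<le> 1}"
      then show "hnorm (D x) \<le> C" using C(2)[of x] mult_left_mono[of "hnorm x" 1 C] C(1) by simp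
    qed
  qed (use y ny in auto)
  moreover have "hnorm (D ?y) = hnorm (D x) / hnorm x"
    unfolding bop_scale[OF D x] hnorm_scale using pos by (simp del: of_real_divide)
  ultimately show ?thesis using pos pos_divide_le_eq[OF pos] by metis
qed

subsection \<open>Topologies on operators\<close>

lemma limitin_generated_by:
  assumes "l \<in> \<Union>B" "\<And>U. U \<in> B \<Longrightarrow> l \<in> U \<Longrightarrow> eventually (\<lambda>n. f n \<in> U) F"
  shows "limitin (topology_generated_by B) f l F"
  unfolding limitin_def
proof (intro conjI allI impI)
  show "l \<in> topspace (topology_generated_by B)" using assms(1) by simp
  fix U assume U: "openin (topology_generated_by B) U \<and> l \<in> U"
  then have "generate_topology_on B U" "l \<in> U" by (auto dest: openin_topology_generated_by)
  then show "eventually (\<lambda>n. f n \<in> U) F"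
  proof (induction rule: generate_topology_on.induct)
    case (Int a b)
    then show ?case by (auto intro: eventually_conj)
  next
    case (UN K)
    then obtain k where "k \<in> K" "l \<in> k" by auto
    with UN.IH have "eventually (\<lambda>n. f n \<in> k) F" by blast
    then show ?case by (rule eventually_mono) (use \<open>k \<in> K\<close> in auto)
  qed (use assms in auto)
qed

lemma limitin_subtopology_closure_of:
  assumes "limitin (subtopology X A) f l sequentially" "\<And>n::nat. f n \<in> S"
  shows "l \<in> subtopology X A closure_of S"
proof (rule in_closure_of[THEN iffD2], intro conjI allI impI)
  show "l \<in> topspace (subtopology X A)" by (rule limitin_topspace[OF assms(1)])
  fix U assume "l \<in> U \<and> openin (subtopology X A) U"
  then have "eventually (\<lambda>n. f n \<in> U) sequentially" using assms(1) by (auto simp: limitin_def)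
  then show "\<exists>y. y \<in> S \<and> y \<in> U"
    using assms(2) by (auto simp: eventually_sequentially)
qed

lemma topspace_norm_top [simp]: "topspace (norm_top H) = UNIV"
proof -
  \<comment> \<open>\<open>H\<close> is arbitrary and possibly empty, so the value of
    \<open>opnorm\<close> at zero is unknown; the radius is that value plus 1.\<close>
  have "S \<in> {S'. opnorm H (\<lambda>x p. S' x p - S x p) < opnorm H (\<lambda>x p. S x p - S x p) + 1}" for S
    by simp
  then show ?thesis unfolding norm_top_def topology_generated_by_topspace by blast
qed

lemma topspace_wot [simp]: "topspace (wot (ell2 P)) = UNIV"
proof -
  have "{S. iprod (S (\<lambda>p. 0)) (\<lambda>p. 0) \<in> UNIV} \<in>
     {{S. iprod (S x) y \<in> U} | x y U. x \<in> ell2 P \<and> y \<in> ell2 P \<and> open U}"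
    using ell2_zero open_UNIV by blast
  then show ?thesis unfolding wot_def topology_generated_by_topspace by auto
qed

lemma topspace_weak_star_top [simp]: "topspace (weak_star_top (ell2 P)) = UNIV"
proof -
  have "{S. sigma_weak_fun (\<lambda>n p. 0) (\<lambda>n p. 0) S \<in> UNIV} \<in>
     {{S. sigma_weak_fun xs ys S \<in> U} | xs ys U.
        (\<forall>n. xs n \<in> ell2 P \<and> ys n \<in> ell2 P) \<and>
        (\<lambda>n. (hnorm (xs n))\<^sup>2) summable_on UNIV \<and>
        (\<lambda>n. (hnorm (ys n))\<^sup>2) summable_on UNIV \<and> open U}"
    by (rule CollectI, intro exI[of _ "\<lambda>n p. 0"] exI[of _ UNIV]) simp
  then show ?thesis unfolding weak_star_top_def topology_generated_by_topspace by auto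
qed

lemma openin_weak_star_basis:
  assumes "\<And>n. xs n \<in> H" "\<And>n. ys n \<in> H" "(\<lambda>n. (hnorm (xs n))\<^sup>2) summable_on UNIV"
    "(\<lambda>n. (hnorm (ys n))\<^sup>2) summable_on UNIV" "open U"
  shows "openin (weak_star_top H) {S. sigma_weak_fun xs ys S \<in> U}"
  unfolding weak_star_top_def by (rule topology_generated_by_Basis) (use assms in blast)

text \<open>A coordinate of \<open>S x - T x\<close> is at most the operator norm of the difference
  times \<open>hnorm x\<close>. The restriction to \<open>bop\<close> matters: outside it
  \<open>opnorm\<close> may be the supremum of an unbounded set and then bounds nothing.\<close>

lemma continuous_map_eval_norm_top:
  assumes x: "x \<in> ell2 P"
  shows "continuous_map (subtopology (norm_top (ell2 P)) (bop (ell2 P))) euclidean (\<lambda>S. S x p)"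
    (is "continuous_map ?X _ _")
proof -
  have nbhd: "\<exists>N. openin ?X N \<and> T \<in> N \<and> (\<forall>S\<in>N. S x p \<in> U)"
    if U: "open U" "T x p \<in> U" and T: "T \<in> bop (ell2 P)" for T U
  proof -
    obtain e where e: "0 < e" "ball (T x p) e \<subseteq> U" using U by (meson open_contains_ball)
    let ?N = "{S. opnorm (ell2 P) (\<lambda>x p. S x p - T x p) < e / (hnorm x + 1)}"
    have pos: "0 < hnorm x + 1" using hnorm_nonneg[of x] by linarith
    have "openin (norm_top (ell2 P)) ?N"
      unfolding norm_top_def by (rule topology_generated_by_Basis) blast
    then have op: "openin (subtopology (norm_top (ell2 P)) (bop (ell2 P))) (?N \<inter> bop (ell2 P))"
      by (auto simp: openin_subtopology)
    have "opnorm (ell2 P) (\<lambda>x p. T x p - T x p) = Sup ((\<lambda>x. 0) ` {x \<in> ell2 P. hnorm x \<le> 1})"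
      by (simp add: opnorm_def)
    also have "\<dots> = (0::real)"
      using ell2_zero hnorm_zero by (subst image_constant[of "\<lambda>p. 0"]) auto
    finally have TN: "T \<in> ?N" using e pos by simp
    have sub: "S x p \<in> U" if S: "S \<in> ?N \<inter> bop (ell2 P)" for S
    proof -
      have D: "(\<lambda>x p. S x p - T x p) \<in> bop (ell2 P)"
        using bop_lincomb_op[of S P T 1 "-1"] S T by simp
      have "cmod (S x p - T x p) \<le> hnorm (\<lambda>p. S x p - T x p)"
        using cmod_le_hnorm[OF bop_in[OF D x]] .
      also have "\<dots> \<le> opnorm (ell2 P) (\<lambda>x p. S x p - T x p) * hnorm x"
        using hnorm_le_opnorm[OF D x] .
      also have "\<dots> \<le> e / (hnorm x + 1) * hnorm x"
        using S by (intro mult_right_mono) auto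
      also have "\<dots> < e" using e pos by (simp add: field_simps)
      finally show ?thesis using e by (auto simp: dist_norm norm_minus_commute)
    qed
    show ?thesis using op TN T sub by blast
  qed
  have "openin ?X {T \<in> topspace ?X. T x p \<in> U}" if U: "open U" for U
  proof (rule openin_subopen[THEN iffD2], rule ballI)
    fix T assume "T \<in> {T \<in> topspace ?X. T x p \<in> U}"
    then obtain N where N: "openin ?X N" "T \<in> N" "\<forall>S\<in>N. S x p \<in> U"
      using nbhd[OF U] by auto
    then show "\<exists>N. openin ?X N \<and> T \<in> N \<and> N \<subseteq> {T \<in> topspace ?X. T x p \<in> U}"
      using openin_subset[OF N(1)] by blast
  qed
  then show ?thesis by (simp add: continuous_map_def)
qed

lemma continuous_map_eval_wot:
  assumes x: "x \<in> ell2 P" and p: "p \<in> P"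
  shows "continuous_map (subtopology (wot (ell2 P)) A) euclidean (\<lambda>S. S x p)"
proof -
  have "openin (wot (ell2 P)) {S. S x p \<in> U}" if "open U" for U
  proof -
    have "{S. S x p \<in> U} = {S. iprod (S x) (xi p) \<in> U}" by (simp add: iprod_xi)
    then show ?thesis
      unfolding wot_def
      by (intro topology_generated_by_Basis) (use x xi_in_ell2[OF p] that in blast)
  qed
  then have "continuous_map (wot (ell2 P)) euclidean (\<lambda>S. S x p)"
    by (auto simp: continuous_map_def)
  then show ?thesis by (rule continuous_map_from_subtopology)
qed

lemma continuous_map_eval_weak_star:
  assumes x: "x \<in> ell2 P" and p: "p \<in> P"
  shows "continuous_map (subtopology (weak_star_top (ell2 P)) A) euclidean (\<lambda>S. S x p)"
proof -
  \<comment> \<open>A single matrix entry is the sigma-weak functional of two sequences concentrated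
    at index 0.\<close>
  let ?xs = "\<lambda>n::nat. if n = 0 then x else (\<lambda>p. 0)"
  let ?ys = "\<lambda>n::nat. if n = 0 then xi p else (\<lambda>p. 0)"
  have eq: "sigma_weak_fun ?xs ?ys S = S x p" for S
  proof -
    have "sigma_weak_fun ?xs ?ys S = infsum (\<lambda>n. iprod (S (?xs n)) (?ys n)) {0}"
      unfolding sigma_weak_fun_def by (rule infsum_cong_neutral) auto
    then show ?thesis by (simp add: iprod_xi)
  qed
  have s: "(\<lambda>n. (hnorm (zs n))\<^sup>2) summable_on UNIV"
    if "\<And>n::nat. n \<noteq> 0 \<Longrightarrow> zs n = (\<lambda>p. 0)" for zs :: "nat \<Rightarrow> 'a \<Rightarrow> complex"
    by (rule summable_on_cong_neutral[where T = "{0}", THEN iffD2]) (use that in auto)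
  have "openin (weak_star_top (ell2 P)) {S. S x p \<in> U}" if "open U" for U
    using openin_weak_star_basis[of ?xs "ell2 P" ?ys U] x p that by (simp add: eq s)
  then have "continuous_map (weak_star_top (ell2 P)) euclidean (\<lambda>S. S x p)"
    by (auto simp: continuous_map_def)
  then show ?thesis by (rule continuous_map_from_subtopology)
qed

lemma infsum_eq_suminf_dominated:
  fixes f :: "nat \<Rightarrow> 'a::banach"
  assumes "\<And>k. norm (f k) \<le> M k" "summable M"
  shows "infsum f UNIV = suminf f"
proof -
  have s: "summable (\<lambda>k. norm (f k))"
    by (rule summable_comparison_test'[OF assms(2)]) (use assms(1) in auto)
  show ?thesis
    by (rule infsumI[OF norm_summable_imp_has_sum[OF s summable_sums[OF summable_norm_cancel[OF s]]]])
qed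

text \<open>Coordinatewise convergence with a common bound gives convergence of every
  \<open>iprod (T n x) y\<close>, which is the WOT statement. Tannery's theorem then moves the limit
  inside the series of a sigma-weak functional.\<close>

lemma bounded_pointwise_limit:
  assumes T: "\<And>n::nat. T n \<in> bop (ell2 P)" "L \<in> bop (ell2 P)"
    and C0: "0 \<le> C" and C: "\<And>n x. x \<in> ell2 P \<Longrightarrow> hnorm (T n x) \<le> C * hnorm x"
    and lim: "\<And>x p. x \<in> ell2 P \<Longrightarrow> p \<in> P \<Longrightarrow> (\<lambda>n. T n x p) \<longlonglongrightarrow> L x p"
  shows "limitin (wot (ell2 P)) T L sequentially" "limitin (weak_star_top (ell2 P)) T L sequentially"
proof -
  have ip: "(\<lambda>n. iprod (T n x) y) \<longlonglongrightarrow> iprod (L x) y" if x: "x \<in> ell2 P" and y: "y \<in> ell2 P" for x y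
  proof (rule iprod_tendsto[OF bop_in[OF T(1) x] C[OF x] _ bop_in[OF T(2) x] y])
    fix p show "(\<lambda>n. T n x p) \<longlonglongrightarrow> L x p"
      using lim[OF x] ell2_outside[OF bop_in[OF T(1) x]] ell2_outside[OF bop_in[OF T(2) x]]
      by (cases "p \<in> P") auto
  qed
  show "limitin (wot (ell2 P)) T L sequentially"
    unfolding wot_def
  proof (rule limitin_generated_by)
    show "L \<in> \<Union> {{S. iprod (S x) y \<in> U} |x y U. x \<in> ell2 P \<and> y \<in> ell2 P \<and> open U}"
      using topspace_wot[of P, unfolded wot_def topology_generated_by_topspace] by simp
    fix U assume "U \<in> {{S. iprod (S x) y \<in> U} |x y U. x \<in> ell2 P \<and> y \<in> ell2 P \<and> open U}" "L \<in> U"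
    then show "\<forall>\<^sub>F n in sequentially. T n \<in> U"
      using topological_tendstoD[OF ip] by auto
  qed
  show "limitin (weak_star_top (ell2 P)) T L sequentially"
    unfolding weak_star_top_def
  proof (rule limitin_generated_by)
    show "L \<in> \<Union> {{S. sigma_weak_fun xs ys S \<in> U} | xs ys U.
        (\<forall>n. xs n \<in> ell2 P \<and> ys n \<in> ell2 P) \<and>
        (\<lambda>n. (hnorm (xs n))\<^sup>2) summable_on UNIV \<and>
        (\<lambda>n. (hnorm (ys n))\<^sup>2) summable_on UNIV \<and> open U}"
      using topspace_weak_star_top[of P, unfolded weak_star_top_def topology_generated_by_topspace]
      by simp
    fix U assume "U \<in> {{S. sigma_weak_fun xs ys S \<in> U} | xs ys U.
        (\<forall>n. xs n \<in> ell2 P \<and> ys n \<in> ell2 P) \<and>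
        (\<lambda>n. (hnorm (xs n))\<^sup>2) summable_on UNIV \<and>
        (\<lambda>n. (hnorm (ys n))\<^sup>2) summable_on UNIV \<and> open U}" and LU: "L \<in> U"
    then obtain xs ys U' where U: "U = {S. sigma_weak_fun xs ys S \<in> U'}" "open U'"
      and xs: "\<And>n. xs n \<in> ell2 P" "(\<lambda>n. (hnorm (xs n))\<^sup>2) summable_on UNIV"
      and ys: "\<And>n. ys n \<in> ell2 P" "(\<lambda>n. (hnorm (ys n))\<^sup>2) summable_on UNIV"
      by blast
    \<comment> \<open>Dominating series, free of \<open>n\<close>: Cauchy-Schwarz, the common bound,
      and the fact that a product of nonnegative reals is at most the sum of their squares.\<close>
    let ?M = "\<lambda>k. C * ((hnorm (xs k))\<^sup>2 + (hnorm (ys k))\<^sup>2)"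
    have M: "norm (iprod (T n (xs k)) (ys k)) \<le> ?M k" for n k
    proof -
      have "norm (iprod (T n (xs k)) (ys k)) \<le> hnorm (T n (xs k)) * hnorm (ys k)"
        by (rule ell2_mult_summable(2)[OF bop_in[OF T(1) xs(1)] ys(1)])
      also have "\<dots> \<le> C * hnorm (xs k) * hnorm (ys k)"
        by (intro mult_right_mono C xs) auto
      also have "\<dots> \<le> ?M k"
        unfolding mult.assoc
        using sum_squares_bound[of "hnorm (xs k)" "hnorm (ys k)"]
          mult_nonneg_nonneg[OF hnorm_nonneg[of "xs k"] hnorm_nonneg[of "ys k"]]
        by (intro mult_left_mono[OF _ C0]) linarith
      finally show ?thesis .
    qed
    have sM: "summable ?M"
      by (intro summable_mult summable_add summable_on_imp_summable xs ys)
    have "\<forall>\<^sub>F (k, n) in at_top \<times>\<^sub>F sequentially. norm (iprod (T n (xs k)) (ys k)) \<le> ?M k"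
      using M by (intro always_eventually) simp
    then have "(\<lambda>n. suminf (\<lambda>k. iprod (T n (xs k)) (ys k))) \<longlonglongrightarrow> suminf (\<lambda>k. iprod (L (xs k)) (ys k))"
      using tannerys_theorem[of "\<lambda>k n. iprod (T n (xs k)) (ys k)" "\<lambda>k. iprod (L (xs k)) (ys k)" sequentially ?M]
        ip[OF xs(1) ys(1)] sM by simp
    moreover have "sigma_weak_fun xs ys (T n) = suminf (\<lambda>k. iprod (T n (xs k)) (ys k))" for n
      unfolding sigma_weak_fun_def by (rule infsum_eq_suminf_dominated[OF M sM])
    moreover have "norm (iprod (L (xs k)) (ys k)) \<le> ?M k" for k
      by (rule LIMSEQ_le_const2[OF tendsto_norm[OF ip[OF xs(1) ys(1)]]]) (use M in auto)
    then have "sigma_weak_fun xs ys L = suminf (\<lambda>k. iprod (L (xs k)) (ys k))"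
      unfolding sigma_weak_fun_def by (rule infsum_eq_suminf_dominated[OF _ sM])
    ultimately have "(\<lambda>n. sigma_weak_fun xs ys (T n)) \<longlonglongrightarrow> sigma_weak_fun xs ys L" by simp
    from topological_tendstoD[OF this U(2)] show "\<forall>\<^sub>F n in sequentially. T n \<in> U"
      using U LU by simp
  qed
qed

subsection \<open>Paths and convolution operators\<close>

text \<open>The encoding of a path stores its range, so the source has to be computed; the vertex
  argument is the answer only for the empty path.\<close>

primrec vend :: "('e \<Rightarrow> 'v) \<Rightarrow> 'v \<Rightarrow> 'e list \<Rightarrow> 'v" where
  "vend s v [] = v"
| "vend s v (e # es) = vend s (s e) es"

lemma vend_append [simp]: "vend s v (es @ fs) = vend s (vend s v es) fs"
  by (induction es arbitrary: v) auto

lemma vend_take_drop: "vend s (vend s v (take k es)) (drop k es) = vend s v es"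
  by (metis append_take_drop_id vend_append)

definition coef :: "('e \<Rightarrow> 'v) \<Rightarrow> (('v \<times> 'e list \<Rightarrow> complex) \<Rightarrow> ('v \<times> 'e list \<Rightarrow> complex)) \<Rightarrow>
    'v \<Rightarrow> 'e list \<Rightarrow> complex" where
  "coef s S v es = S (xi (vend s v es, [])) (v, es)"

text \<open>The index \<open>k\<close> runs over the cuts of a path into a left factor
  \<open>take k gs\<close> and a right factor \<open>drop k gs\<close>. Each coordinate involves
  finitely many matrix entries, so the identity survives every limit that converges
  coordinatewise.\<close>

definition conv_ops where
  "conv_ops V E r s = {S \<in> bop (HG V E r s). \<forall>x\<in>HG V E r s. \<forall>v gs. (v, gs) \<in> fsg V E r s \<longrightarrow>
     S x (v, gs) = (\<Sum>k\<le>length gs. coef s S v (take k gs) * x (vend s v (take k gs), drop k gs))}"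

primrec Lpath where
  "Lpath V E r s v [] = Pop V E r s v"
| "Lpath V E r s v (e # es) = Lop V E r s e \<circ> Lpath V E r s (s e) es"

text \<open>Two cuts of a word can be listed by the first one and the distance to the second, or by
  the second one and the first: the combinatorics behind associativity of convolution.\<close>

lemma sum_triangle_swap:
  fixes g :: "nat \<Rightarrow> nat \<Rightarrow> 'a::comm_monoid_add"
  shows "(\<Sum>k\<le>N. \<Sum>j\<le>N - k. g k j) = (\<Sum>m\<le>N. \<Sum>k\<le>m. g k (m - k))"
proof -
  have "(\<Sum>k\<le>N. \<Sum>j\<le>N - k. g k j) = (\<Sum>(k, j)\<in>Sigma {..N} (\<lambda>k. {..N - k}). g k j)"
    by (rule sum.Sigma) auto
  also have "Sigma {..N} (\<lambda>k. {..N - k}) = {(k, j). k + j \<le> N}" by auto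
  finally show ?thesis by (simp only: sum.triangle_reindex_eq)
qed

lemma sum_single:
  assumes "finite A" "j \<in> A" "\<And>k. k \<in> A \<Longrightarrow> k \<noteq> j \<Longrightarrow> f k = 0"
  shows "sum f A = f j"
  using assms by (subst sum.remove[of A j]) (auto intro: sum.neutral)

locale graph =
  fixes V :: "'v set" and E :: "'e set" and r s :: "'e \<Rightarrow> 'v"
  assumes graph: "countable_graph V E r s"
begin

abbreviation "P \<equiv> fsg V E r s"
abbreviation "H \<equiv> ell2 (fsg V E r s)"
abbreviation "CO \<equiv> conv_ops V E r s"
abbreviation "L \<equiv> Lop V E r s"
abbreviation "Q \<equiv> Pop V E r s"
abbreviation "LP \<equiv> Lpath V E r s"
abbreviation "cf \<equiv> coef s"

section \<open>Paths and their factorizations\<close>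

lemma source_in_V [simp]: "e \<in> E \<Longrightarrow> s e \<in> V" and range_in_V [simp]: "e \<in> E \<Longrightarrow> r e \<in> V"
  using graph by (auto simp: countable_graph_def)

lemma path_Nil [simp]: "(v, []) \<in> P \<longleftrightarrow> v \<in> V"
  by (auto simp: fsg_def)

lemma path_Cons [simp]: "(v, e # es) \<in> P \<longleftrightarrow> e \<in> E \<and> r e = v \<and> (s e, es) \<in> P"
proof -
  have "(\<forall>i. Suc i < length (e # es) \<longrightarrow> s ((e # es) ! i) = r ((e # es) ! Suc i)) \<longleftrightarrow>
    (es \<noteq> [] \<longrightarrow> r (hd es) = s e) \<and> (\<forall>i. Suc i < length es \<longrightarrow> s (es ! i) = r (es ! Suc i))"
    (is "?l \<longleftrightarrow> ?a \<and> ?b")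
  proof
    assume l: ?l
    have "?a" using l[rule_format, of 0] by (cases es) auto
    moreover have ?b using l[rule_format, of "Suc _"] by auto
    ultimately show "?a \<and> ?b" by blast
  next
    assume ab: "?a \<and> ?b"
    show ?l
    proof (intro allI impI)
      fix i assume "Suc i < length (e # es)"
      then show "s ((e # es) ! i) = r ((e # es) ! Suc i)"
        using ab by (cases i; cases es) auto
    qed
  qed
  then show ?thesis by (auto simp: fsg_def)
qed

lemma path_start: "(v, es) \<in> P \<Longrightarrow> v \<in> V"
  by (auto simp: fsg_def)

lemma path_append: "(v, es @ fs) \<in> P \<longleftrightarrow> (v, es) \<in> P \<and> (vend s v es, fs) \<in> P"
  by (induction es arbitrary: v) (auto dest: path_start)

lemma path_take: "(v, es) \<in> P \<Longrightarrow> (v, take k es) \<in> P"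
  and path_drop: "(v, es) \<in> P \<Longrightarrow> (vend s v (take k es), drop k es) \<in> P"
  by (metis append_take_drop_id path_append)+

lemma path_end: "(v, es) \<in> P \<Longrightarrow> vend s v es \<in> V"
  using path_append[of v es "[]"] by simp

section \<open>Convolution operators form an algebra\<close>

lemma conv_opsI:
  assumes "S \<in> bop H"
    "\<And>x v gs. x \<in> H \<Longrightarrow> (v, gs) \<in> P \<Longrightarrow>
      S x (v, gs) = (\<Sum>k\<le>length gs. cf S v (take k gs) * x (vend s v (take k gs), drop k gs))"
  shows "S \<in> CO"
  using assms by (auto simp: conv_ops_def HG_def)

lemma conv_ops_bop: "S \<in> CO \<Longrightarrow> S \<in> bop H"
  by (simp add: conv_ops_def HG_def)

lemma conv_ops_apply:
  "S \<in> CO \<Longrightarrow> x \<in> H \<Longrightarrow> (v, gs) \<in> P \<Longrightarrow>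
      S x (v, gs) = (\<Sum>k\<le>length gs. cf S v (take k gs) * x (vend s v (take k gs), drop k gs))"
  by (simp add: conv_ops_def HG_def)

lemma cf_op_add: "cf (op_add S T) v es = cf S v es + cf T v es"
  by (simp add: coef_def op_add_def)

lemma cf_op_scale: "cf (op_scale c S) v es = c * cf S v es"
  by (simp add: coef_def op_scale_def)

lemma conv_ops_add:
  assumes "S \<in> CO" "T \<in> CO"
  shows "op_add S T \<in> CO"
proof (rule conv_opsI)
  show "op_add S T \<in> bop H" using assms by (intro bop_op_add conv_ops_bop)
qed (simp add: cf_op_add, simp add: op_add_def conv_ops_apply assms distrib_right sum.distrib)

lemma conv_ops_scale:
  assumes "S \<in> CO"
  shows "op_scale c S \<in> CO"
proof (rule conv_opsI)
  show "op_scale c S \<in> bop H" using assms by (intro bop_op_scale conv_ops_bop)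
qed (simp add: cf_op_scale, simp add: op_scale_def conv_ops_apply assms sum_distrib_left mult.assoc)

text \<open>\<open>T\<close> applied to the basis vector at the source of the path lists the
  coefficients of \<open>T\<close> on the paths with that source, and \<open>S\<close> convolves
  that vector.\<close>

lemma cf_comp:
  assumes S: "S \<in> CO" and T: "T \<in> CO" and p: "(v, es) \<in> P"
  shows "cf (S \<circ> T) v es =
    (\<Sum>k\<le>length es. cf S v (take k es) * cf T (vend s v (take k es)) (drop k es))"
proof -
  have x: "T (xi (vend s v es, [])) \<in> H"
    by (intro bop_in[OF conv_ops_bop[OF T]] xi_in_ell2) (simp add: path_end[OF p])
  show ?thesis
    unfolding coef_def[of s "S \<circ> T"] o_apply conv_ops_apply[OF S x p]
    by (simp add: coef_def[of s T] vend_take_drop)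
qed

text \<open>Associativity of convolution: the terms for two cuts \<open>k \<le> m\<close> are
  regrouped by the outer cut \<open>m\<close>, and the inner sum over \<open>k\<close> is the
  coefficient of the product at \<open>take m gs\<close>.\<close>

lemma conv_ops_comp:
  assumes S: "S \<in> CO" and T: "T \<in> CO"
  shows "S \<circ> T \<in> CO"
proof (rule conv_opsI)
  show "S \<circ> T \<in> bop H" by (intro bop_comp conv_ops_bop S T)
  fix x v gs assume x: "x \<in> H" and p: "(v, gs) \<in> P"
  let ?v = "\<lambda>k. vend s v (take k gs)"
  let ?g = "\<lambda>k j. cf S v (take k gs) * (cf T (?v k) (take j (drop k gs)) *
     x (vend s (?v k) (take j (drop k gs)), drop j (drop k gs)))"
  have Tx: "T x \<in> H" by (rule bop_in[OF conv_ops_bop[OF T] x])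
  have "(S \<circ> T) x (v, gs) = (\<Sum>k\<le>length gs. \<Sum>j\<le>length gs - k. ?g k j)"
    by (simp add: conv_ops_apply[OF S Tx p] conv_ops_apply[OF T x path_drop[OF p]] sum_distrib_left
        del: drop_drop)
  also have "\<dots> = (\<Sum>m\<le>length gs. \<Sum>k\<le>m. ?g k (m - k))"
    by (rule sum_triangle_swap)
  also have "\<dots> = (\<Sum>m\<le>length gs. cf (S \<circ> T) v (take m gs) * x (?v m, drop m gs))"
  proof (rule sum.cong[OF refl])
    fix m assume m: "m \<in> {..length gs}"
    have "(\<Sum>k\<le>m. ?g k (m - k)) = (\<Sum>k\<le>m. cf S v (take k (take m gs)) *
        cf T (vend s v (take k (take m gs))) (drop k (take m gs)) * x (?v m, drop m gs))"
    proof (rule sum.cong[OF refl])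
      fix k assume k: "k \<in> {..m}"
      have 1: "take k (take m gs) = take k gs" using k by (simp add: min_def)
      have 2: "take (m - k) (drop k gs) = drop k (take m gs)" by (simp add: drop_take)
      have 3: "drop (m - k) (drop k gs) = drop m gs" using k by simp
      have 4: "vend s (?v k) (drop k (take m gs)) = ?v m"
        using vend_take_drop[of s v k "take m gs"] 1 by simp
      show "?g k (m - k) = cf S v (take k (take m gs)) *
        cf T (vend s v (take k (take m gs))) (drop k (take m gs)) * x (?v m, drop m gs)"
        unfolding 1 2 3 4 by (simp add: mult.assoc)
    qed
    also have "\<dots> = cf (S \<circ> T) v (take m gs) * x (?v m, drop m gs)"
      using m by (simp add: cf_comp[OF S T path_take[OF p]] sum_distrib_right min_def)
    finally show "(\<Sum>k\<le>m. ?g k (m - k)) = cf (S \<circ> T) v (take m gs) * x (?v m, drop m gs)" .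
  qed
  finally show "(S \<circ> T) x (v, gs) = (\<Sum>m\<le>length gs. cf (S \<circ> T) v (take m gs) * x (?v m, drop m gs))" .
qed

section \<open>Generators and their closures consist of convolution operators\<close>

lemma Pop_apply: "x \<in> H \<Longrightarrow> Q u x (v, es) = (if v = u then x (v, es) else 0)"
  by (simp add: Pop_def HG_def)

lemma Lop_apply:
  "x \<in> H \<Longrightarrow> L e x (v, es) = (if es \<noteq> [] \<and> hd es = e \<and> v = r e then x (s e, tl es) else 0)"
  by (simp add: Lop_def HG_def)

lemma Pop_bop: "Q u \<in> bop H"
proof -
  have eq: "Q u x = cpull {p. fst p = u} id x" if "x \<in> H" for x
    using that by (auto simp: Pop_def HG_def cpull_def)
  show ?thesis
  proof (rule bopI[where C = 1])
    fix x assume x: "x \<in> H"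
    show "Q u x \<in> H" unfolding eq[OF x] by (rule cpull_in_ell2[OF x]) auto
    show "hnorm (Q u x) \<le> 1 * hnorm x" unfolding eq[OF x] using cpull_bound(2)[OF x inj_on_id] by simp
  qed (auto simp: eq ell2_lincomb cpull_lincomb, simp add: Pop_def HG_def)
qed

lemma Lop_bop:
  assumes e: "e \<in> E"
  shows "L e \<in> bop H"
proof -
  let ?A = "{(v, es). es \<noteq> [] \<and> hd es = e \<and> v = r e}"
  let ?h = "\<lambda>(v, es). (s e, tl es)"
  have inj: "inj_on ?h ?A"
    by (auto simp: inj_on_def intro: list.expand)
  have eq: "L e x = cpull ?A ?h x" if "x \<in> H" for x
    using that by (auto simp: Lop_def HG_def cpull_def)
  show ?thesis
  proof (rule bopI[where C = 1])
    fix x assume x: "x \<in> H"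
    show "L e x \<in> H"
      unfolding eq[OF x]
    proof (rule cpull_in_ell2[OF x inj])
      fix q assume "q \<in> ?A" "?h q \<in> P"
      then show "q \<in> P" using e by (cases q; cases "snd q") auto
    qed
    show "hnorm (L e x) \<le> 1 * hnorm x" unfolding eq[OF x] using cpull_bound(2)[OF x inj] by simp
  qed (auto simp: eq ell2_lincomb cpull_lincomb, simp add: Lop_def HG_def)
qed

lemma cf_Pop: "(v, es) \<in> P \<Longrightarrow> cf (Q u) v es = (if v = u \<and> es = [] then 1 else 0)"
  using path_end[of v es] by (auto simp: coef_def Pop_apply xi_apply)

lemma cf_Lop: "(v, es) \<in> P \<Longrightarrow> cf (L e) v es = (if es = [e] then 1 else 0)"
  using path_end[of v es]
  by (cases es; cases "tl es") (auto simp: coef_def Lop_apply xi_apply)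

lemma Pop_conv: "Q u \<in> CO"
proof (rule conv_opsI[OF Pop_bop])
  fix x v gs assume x: "x \<in> H" and p: "(v, gs) \<in> P"
  show "Q u x (v, gs) = (\<Sum>k\<le>length gs. cf (Q u) v (take k gs) * x (vend s v (take k gs), drop k gs))"
    using path_start[OF p]
    by (subst sum_single[where j = 0]) (auto simp: cf_Pop path_take[OF p] Pop_apply[OF x])
qed

lemma Lop_conv:
  assumes "e \<in> E"
  shows "L e \<in> CO"
proof (rule conv_opsI[OF Lop_bop[OF assms]])
  fix x v gs assume x: "x \<in> H" and p: "(v, gs) \<in> P"
  have c: "cf (L e) v (take k gs) = (if take k gs = [e] then 1 else 0)" for k
    by (rule cf_Lop[OF path_take[OF p]])
  show "L e x (v, gs) = (\<Sum>k\<le>length gs. cf (L e) v (take k gs) * x (vend s v (take k gs), drop k gs))"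
  proof (cases gs)
    case Nil
    then show ?thesis using c[of 0] by (simp add: Lop_apply[OF x])
  next
    case (Cons g gs')
    \<comment> \<open>Only the cut directly after the first edge can contribute.\<close>
    have "take k gs = [e] \<Longrightarrow> k \<le> length gs \<Longrightarrow> k = 1" for k
      by (metis length_Cons length_take list.size(3) min_absorb2 One_nat_def)
    then show ?thesis
      unfolding c by (subst sum_single[where j = 1]) (use p in \<open>auto simp: Cons Lop_apply[OF x]\<close>)
  qed
qed

lemma alg_gen_conv: "A \<in> alg_gen (L ` E \<union> Q ` V) \<Longrightarrow> A \<in> CO"
proof (induction rule: alg_gen.induct)
  case (mult A B)
  show ?case by (rule conv_ops_comp) fact+
qed (auto intro: Lop_conv Pop_conv conv_ops_add conv_ops_scale)

text \<open>For fixed \<open>x\<close> and a fixed path, the convolution identity is a finite linear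
  relation between continuous scalar functions of the operator, so it cuts out a closed set. The
  topology is left abstract so that the norm closure and the WOT closure are both instances.\<close>

lemma conv_ops_closed:
  assumes cont: "\<And>x p. x \<in> H \<Longrightarrow> p \<in> P \<Longrightarrow>
      continuous_map (subtopology X (bop H)) euclidean (\<lambda>S. S x p)"
    and top: "topspace X = UNIV" and A: "A \<subseteq> CO"
  shows "subtopology X (bop H) closure_of A \<subseteq> CO"
proof
  let ?X = "subtopology X (bop H)"
  fix T assume T: "T \<in> ?X closure_of A"
  have Tb: "T \<in> bop H" using T closure_of_subset_topspace[of ?X A] by auto
  show "T \<in> CO"
  proof (rule conv_opsI[OF Tb])
    fix x v gs assume x: "x \<in> H" and p: "(v, gs) \<in> P"
    let ?f = "\<lambda>S. S x (v, gs) - (\<Sum>k\<le>length gs. cf S v (take k gs) * x (vend s v (take k gs), drop k gs))"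
    have "continuous_map ?X euclidean ?f"
      unfolding continuous_map_atin limitin_canonical_iff coef_def
    proof (intro ballI tendsto_diff tendsto_sum tendsto_mult tendsto_const)
      fix S assume S: "S \<in> topspace ?X"
      show "((\<lambda>S. S x (v, gs)) \<longlongrightarrow> S x (v, gs)) (atin ?X S)"
        using cont[OF x p] S by (simp add: continuous_map_atin)
      fix k
      have "xi (vend s v (take k gs), []) \<in> H"
        using path_end[OF path_take[OF p]] by simp
      from cont[OF this path_take[OF p]]
      show "((\<lambda>S. S (xi (vend s v (take k gs), [])) (v, take k gs)) \<longlongrightarrow>
             S (xi (vend s v (take k gs), [])) (v, take k gs)) (atin ?X S)"
        using S by (simp add: continuous_map_atin)
    qed
    then have "closedin ?X {S \<in> topspace ?X. ?f S \<in> {0}}"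
      by (rule closedin_continuous_map_preimage) simp
    moreover have "A \<subseteq> {S \<in> topspace ?X. ?f S \<in> {0}}"
      using A conv_ops_apply[OF _ x p] top conv_ops_bop by auto
    ultimately have "T \<in> {S \<in> topspace ?X. ?f S \<in> {0}}"
      using T closure_of_minimal by blast
    then show "T x (v, gs) = (\<Sum>k\<le>length gs. cf T v (take k gs) * x (vend s v (take k gs), drop k gs))"
      by simp
  qed
qed

lemma alg_gen_subset_tensor_alg: "alg_gen (L ` E \<union> Q ` V) \<subseteq> tensor_alg V E r s"
  unfolding tensor_alg_def HG_def
  by (rule closure_of_subset) (auto dest: alg_gen_conv intro: conv_ops_bop)

lemma fsga_subset_conv_ops: "fsga V E r s \<subseteq> CO"
proof -
  have "tensor_alg V E r s \<subseteq> CO"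
    unfolding tensor_alg_def HG_def
    by (rule conv_ops_closed) (auto intro: continuous_map_eval_norm_top alg_gen_conv)
  then show ?thesis
    unfolding fsga_def HG_def
    by (intro conv_ops_closed) (auto intro: continuous_map_eval_wot)
qed

lemma Lpath_in_alg_gen: "(v, es) \<in> P \<Longrightarrow> LP v es \<in> alg_gen (L ` E \<union> Q ` V)"
  by (induction es arbitrary: v) (auto intro: alg_gen.intros)

lemma Lpath_bop: "(v, es) \<in> P \<Longrightarrow> LP v es \<in> bop H"
  by (intro conv_ops_bop alg_gen_conv Lpath_in_alg_gen)

lemma Lpath_apply:
  assumes "(v, es) \<in> P" "x \<in> H"
  shows "LP v es x (u, gs) =
    (if u = v \<and> take (length es) gs = es then x (vend s v es, drop (length es) gs) else 0)"
  using assms(1)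
proof (induction es arbitrary: v u gs)
  case Nil
  then show ?case by (simp add: Pop_apply assms)
next
  case (Cons e es)
  have "LP (s e) es x \<in> H" by (rule bop_in[OF Lpath_bop]) (use Cons assms in auto)
  then show ?case using Cons by (cases gs) (auto simp: Lop_apply)
qed

end

subsection \<open>Fejer means and density of polynomials\<close>

lemma has_sum_sum:
  fixes f :: "'i \<Rightarrow> 'a \<Rightarrow> 'b::topological_comm_monoid_add"
  assumes "finite I" "\<And>i. i \<in> I \<Longrightarrow> (f i has_sum S i) A"
  shows "((\<lambda>x. \<Sum>i\<in>I. f i x) has_sum (\<Sum>i\<in>I. S i)) A"
  using assms by (induction I rule: finite_induct) (auto intro: has_sum_add has_sum_0)

context graph
begin

text \<open>\<open>Suc\<close> makes every edge weigh at least 1, so the weight bounds both the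
  length of a word and the indices of its edges.\<close>

definition wt :: "'e list \<Rightarrow> nat" where
  "wt es = sum_list (map (\<lambda>e. Suc (to_nat_on E e)) es)"

lemma wt_append [simp]: "wt (es @ fs) = wt es + wt fs"
  by (simp add: wt_def)

lemma wt_take_drop: "wt (take k es) + wt (drop k es) = wt es"
  by (metis append_take_drop_id wt_append)

definition vlow :: "nat \<Rightarrow> 'v \<Rightarrow> bool" where
  "vlow n v \<longleftrightarrow> to_nat_on V v < n"

text \<open>The weight does not see vertices: all empty paths weigh 0, so vertices need a cutoff of
  their own. Imposing it at both ends matches compression by a coordinate projection on the left and
  on the right.\<close>

definition low_paths :: "nat \<Rightarrow> ('v \<times> 'e list) set" where
  "low_paths n = {(v, es) \<in> P. vlow n v \<and> vlow n (vend s v es) \<and> wt es < n}"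

lemma finite_low_paths: "finite (low_paths n)"
proof -
  have V: "finite {v \<in> V. to_nat_on V v < n}"
    using graph by (intro inj_on_finite[of "to_nat_on V" _ "{..<n}"])
      (auto simp: countable_graph_def intro: inj_on_subset[OF inj_on_to_nat_on])
  have E: "finite {e \<in> E. to_nat_on E e < n}"
    using graph by (intro inj_on_finite[of "to_nat_on E" _ "{..<n}"])
      (auto simp: countable_graph_def intro: inj_on_subset[OF inj_on_to_nat_on])
  have le: "length es \<le> wt es" "e \<in> set es \<Longrightarrow> to_nat_on E e < wt es" for es e
    by (induction es) (auto simp: wt_def)
  have "low_paths n \<subseteq> {v \<in> V. to_nat_on V v < n} \<times>
      {es. set es \<subseteq> {e \<in> E. to_nat_on E e < n} \<and> length es \<le> n}"
  proof (rule subsetI)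
    fix p assume "p \<in> low_paths n"
    then obtain v es where p: "p = (v, es)" "(v, es) \<in> P" "vlow n v" "wt es < n"
      by (auto simp: low_paths_def)
    moreover have "set es \<subseteq> E" using p(2) by (auto simp: fsg_def)
    ultimately show "p \<in> {v \<in> V. to_nat_on V v < n} \<times>
      {es. set es \<subseteq> {e \<in> E. to_nat_on E e < n} \<and> length es \<le> n}"
      using le(1)[of es] le(2)[of _ es] path_start[of v es] by (force simp: vlow_def)
  qed
  then show ?thesis
    by (rule finite_subset) (intro finite_cartesian_product V finite_lists_length_le E)
qed

definition fejer where
  "fejer T n = (\<lambda>x p. \<Sum>(v, es)\<in>low_paths n.
     (of_nat (n - wt es) / of_nat n * cf T v es) * LP v es x p)"

text \<open>\<open>alg_gen\<close> has no rule for zero, so the empty sum is obtained as 0 times a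
  given member \<open>A0\<close>. For the Fejer means a vertex projection supplies that
  member.\<close>

lemma sum_in_alg_gen:
  assumes "finite I" "A0 \<in> alg_gen Gs" "\<And>i. i \<in> I \<Longrightarrow> A i \<in> alg_gen Gs"
  shows "(\<lambda>x p. \<Sum>i\<in>I. c i * A i x p) \<in> alg_gen Gs"
  using assms(1,3)
proof (induction I rule: finite_induct)
  case empty
  have "op_scale 0 A0 \<in> alg_gen Gs" by (rule alg_gen.scale[OF assms(2)])
  then show ?case by (simp add: op_scale_def)
next
  case (insert i I)
  have "op_add (op_scale (c i) (A i)) (\<lambda>x p. \<Sum>i\<in>I. c i * A i x p) \<in> alg_gen Gs"
    by (intro alg_gen.add alg_gen.scale insert) auto
  then show ?case using insert by (simp add: op_add_def op_scale_def)
qed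

lemma fejer_in_alg_gen:
  assumes "V \<noteq> {}"
  shows "fejer T n \<in> alg_gen (L ` E \<union> Q ` V)"
proof -
  obtain v0 where "v0 \<in> V" using assms by auto
  then have "Q v0 \<in> alg_gen (L ` E \<union> Q ` V)" by (auto intro: alg_gen.gen)
  from sum_in_alg_gen[OF finite_low_paths this, of n "\<lambda>(v, es). LP v es"
      "\<lambda>(v, es). of_nat (n - wt es) / of_nat n * cf T v es"]
  show ?thesis
    by (force simp: fejer_def low_paths_def case_prod_unfold intro: Lpath_in_alg_gen)
qed

text \<open>Truncated subtraction makes the factor vanish once \<open>wt es\<close> reaches
  \<open>n\<close>, so the weight condition of \<open>low_paths\<close> is built in.\<close>

definition fejer_weight :: "nat \<Rightarrow> 'v \<Rightarrow> 'e list \<Rightarrow> complex" where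
  "fejer_weight n v es =
     (if vlow n v \<and> vlow n (vend s v es) then of_nat (n - wt es) / of_nat n else 0)"

text \<open>A path operator contributes at \<open>gs\<close> only if its word is a prefix of
  \<open>gs\<close>, so the polynomial acts as convolution with the damped coefficients of
  \<open>T\<close>.\<close>

lemma fejer_apply:
  assumes x: "x \<in> H" and p: "(u, gs) \<in> P"
  shows "fejer T n x (u, gs) = (\<Sum>k\<le>length gs. fejer_weight n u (take k gs) * cf T u (take k gs) *
     x (vend s u (take k gs), drop k gs))"
proof -
  let ?f = "\<lambda>(v, es). (of_nat (n - wt es) / of_nat n * cf T v es) * LP v es x (u, gs)"
  let ?h = "\<lambda>k. (u, take k gs)"
  have inj: "inj_on ?h {..length gs}"
    by (rule inj_on_inverseI[where g = "\<lambda>q. length (snd q)"]) simp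
  have "fejer T n x (u, gs) = sum ?f (low_paths n)"
    by (simp add: fejer_def)
  also have "\<dots> = sum ?f (low_paths n \<inter> ?h ` {..length gs})"
  proof (rule sum.mono_neutral_right[OF finite_low_paths])
    show "\<forall>q\<in>low_paths n - low_paths n \<inter> ?h ` {..length gs}. ?f q = 0"
    proof
      fix q assume q: "q \<in> low_paths n - low_paths n \<inter> ?h ` {..length gs}"
      obtain v es where [simp]: "q = (v, es)" by fastforce
      have pq: "(v, es) \<in> P" using q by (auto simp: low_paths_def)
      have "\<not> (u = v \<and> take (length es) gs = es)"
      proof
        assume a: "u = v \<and> take (length es) gs = es"
        have "length es \<le> length gs" using arg_cong[OF conjunct2[OF a], of length] by simp
        moreover have "q = ?h (length es)" using a by simp
        ultimately show False using q by blast
      qed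
      then show "?f q = 0" by (auto simp: Lpath_apply[OF pq x])
    qed
  qed auto
  also have "\<dots> = (\<Sum>q\<in>?h ` {..length gs}. if q \<in> low_paths n then ?f q else 0)"
    by (subst Int_commute, rule sum.inter_restrict) simp
  also have "\<dots> = (\<Sum>k\<le>length gs. if ?h k \<in> low_paths n then ?f (?h k) else 0)"
    by (subst sum.reindex[OF inj]) (simp add: o_def)
  also have "\<dots> = (\<Sum>k\<le>length gs. fejer_weight n u (take k gs) * cf T u (take k gs) *
     x (vend s u (take k gs), drop k gs))"
  proof (rule sum.cong[OF refl])
    fix k assume "k \<in> {..length gs}"
    then show "(if ?h k \<in> low_paths n then ?f (?h k) else 0) =
      fejer_weight n u (take k gs) * cf T u (take k gs) * x (vend s u (take k gs), drop k gs)"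
      using Lpath_apply[OF path_take[OF p] x, of k u gs] path_take[OF p, of k]
      by (auto simp: low_paths_def fejer_weight_def min_def)
  qed
  finally show ?thesis .
qed

lemma fejer_weight_tendsto: "(\<lambda>n. fejer_weight n v es) \<longlonglongrightarrow> 1"
proof -
  have "(\<lambda>n. 1 - complex_of_real (real (wt es) / real n)) \<longlonglongrightarrow> 1 - complex_of_real 0"
    by (intro tendsto_diff tendsto_const tendsto_of_real lim_const_over_n)
  moreover have "\<forall>\<^sub>F n in sequentially. fejer_weight n v es = 1 - complex_of_real (real (wt es) / real n)"
    unfolding eventually_sequentially
  proof (intro exI allI impI)
    \<comment> \<open>The threshold makes \<open>n\<close> positive and larger than the weight and
      than the indices of both end vertices.\<close>
    fix n assume n: "Suc (wt es + to_nat_on V v + to_nat_on V (vend s v es)) \<le> n"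
    then have "complex_of_nat (n - wt es) = of_nat n - of_nat (wt es)" by (simp add: of_nat_diff)
    then show "fejer_weight n v es = 1 - complex_of_real (real (wt es) / real n)"
      using n by (simp add: fejer_weight_def vlow_def diff_divide_distrib)
  qed
  ultimately show ?thesis by (simp add: tendsto_cong)
qed

lemma fejer_pointwise:
  assumes T: "T \<in> CO" and x: "x \<in> H" and p: "p \<in> P"
  shows "(\<lambda>n. fejer T n x p) \<longlonglongrightarrow> T x p"
proof -
  obtain u gs where [simp]: "p = (u, gs)" by fastforce
  have p': "(u, gs) \<in> P" using p by simp
  have "(\<lambda>n. \<Sum>k\<le>length gs. fejer_weight n u (take k gs) * cf T u (take k gs) *
     x (vend s u (take k gs), drop k gs)) \<longlonglongrightarrow> (\<Sum>k\<le>length gs. 1 * cf T u (take k gs) *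
     x (vend s u (take k gs), drop k gs))"
    by (intro tendsto_sum tendsto_mult tendsto_const fejer_weight_tendsto)
  then show ?thesis
    by (simp add: fejer_apply[OF x p'] conv_ops_apply[OF T x p'])
qed

text \<open>The window \<open>j - n < wt es \<le> j\<close> of weights, written additively because
  natural subtraction would truncate for small \<open>j\<close>.\<close>

definition block :: "nat \<Rightarrow> nat \<Rightarrow> ('v \<times> 'e list) set" where
  "block n j = {(v, es). vlow n v \<and> wt es \<le> j \<and> j < wt es + n}"

lemma card_block_index_le: "card {j. j < J \<and> q \<in> block n j} \<le> n"
proof -
  obtain v es where [simp]: "q = (v, es)" by fastforce
  have "{j. j < J \<and> q \<in> block n j} \<subseteq> {wt es..<wt es + n}" by (auto simp: block_def)
  then have "card {j. j < J \<and> q \<in> block n j} \<le> card {wt es..<wt es + n}"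
    by (intro card_mono) auto
  then show ?thesis by simp
qed

text \<open>Averaging the compressions of an operator to overlapping blocks of \<open>n\<close> consecutive weights
  multiplies its coefficient at \<open>es\<close> by \<open>1 - wt es / n\<close>; this bounds the norms of the Fejer means.\<close>

lemma fejer_eq_block_average:
  assumes T: "T \<in> CO" and x: "x \<in> H" and p: "(u, gs) \<in> P" and n: "0 < n" and J: "wt gs + n \<le> J"
  shows "fejer T n x (u, gs) = (\<Sum>j<J. if (u, gs) \<in> block n j
      then T (cpull (block n j) id x) (u, gs) else 0) / of_nat n"
proof -
  have bx: "cpull (block n j) id x \<in> H" for j
    by (rule cpull_in_ell2[OF x]) auto
  let ?q = "\<lambda>k. (vend s u (take k gs), drop k gs)"
  have "(\<Sum>j<J. if (u, gs) \<in> block n j then T (cpull (block n j) id x) (u, gs) else 0)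
    = (\<Sum>j<J. \<Sum>k\<le>length gs. cf T u (take k gs) * x (?q k) *
        of_bool ((u, gs) \<in> block n j \<and> ?q k \<in> block n j))"
  proof (rule sum.cong[OF refl])
    fix j
    show "(if (u, gs) \<in> block n j then T (cpull (block n j) id x) (u, gs) else 0) =
       (\<Sum>k\<le>length gs. cf T u (take k gs) * x (?q k) * of_bool ((u, gs) \<in> block n j \<and> ?q k \<in> block n j))"
    proof (cases "(u, gs) \<in> block n j")
      case True
      have "T (cpull (block n j) id x) (u, gs) = (\<Sum>k\<le>length gs. cf T u (take k gs) * cpull (block n j) id x (?q k))"
        by (rule conv_ops_apply[OF T bx p])
      also have "\<dots> = (\<Sum>k\<le>length gs. cf T u (take k gs) * x (?q k) * of_bool ((u, gs) \<in> block n j \<and> ?q k \<in> block n j))"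
        using True by (intro sum.cong refl) (simp add: cpull_def)
      finally show ?thesis using True by simp
    qed simp
  qed
  also have "\<dots> = (\<Sum>k\<le>length gs. cf T u (take k gs) * x (?q k) *
        (\<Sum>j<J. of_bool ((u, gs) \<in> block n j \<and> ?q k \<in> block n j)))"
    by (subst sum.swap) (simp only: sum_distrib_left)
  also have "\<dots> = (\<Sum>k\<le>length gs. cf T u (take k gs) * x (?q k) *
        (fejer_weight n u (take k gs) * of_nat n))"
  proof (intro sum.cong refl arg_cong2[where f = "(*)"])
    fix k
    have w: "wt (take k gs) + wt (drop k gs) = wt gs" by (rule wt_take_drop)
    have "(\<Sum>j<J. of_bool ((u, gs) \<in> block n j \<and> ?q k \<in> block n j) :: complex)
       = of_nat (card {j. j < J \<and> (u, gs) \<in> block n j \<and> ?q k \<in> block n j})"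
      by (simp add: sum_of_bool_eq Int_def)
    \<comment> \<open>The longer path fixes the lower end of the range of \<open>j\<close>, the
      shorter one the upper end; \<open>n - wt (take k gs)\<close> indices remain, and
      \<open>J\<close> is too large to interfere.\<close>
    also have "{j. j < J \<and> (u, gs) \<in> block n j \<and> ?q k \<in> block n j} =
      (if vlow n u \<and> vlow n (vend s u (take k gs)) then {wt gs..<wt (drop k gs) + n} else {})"
      using J w by (auto simp: block_def)
    also have "of_nat (card \<dots>) = fejer_weight n u (take k gs) * of_nat n"
      using n w[symmetric] by (simp add: fejer_weight_def)
    finally show "(\<Sum>j<J. of_bool ((u, gs) \<in> block n j \<and> ?q k \<in> block n j)) =
      fejer_weight n u (take k gs) * of_nat n" .
  qed
  finally show ?thesis
    using n by (simp add: fejer_apply[OF x p] sum_divide_distrib mult_ac)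
qed

text \<open>With R_j the projection onto the j-th block, the mean is 1/n times the sum of the
  compressions R_j T R_j, and the blocks overlap at most n-fold. Cauchy-Schwarz at each coordinate
  costs a factor n, the overlap in the compressed copies of \<open>x\<close> another, and together
  they cancel the n^2 in the denominator; the bound of \<open>T\<close> itself survives.\<close>

lemma fejer_bound:
  assumes T: "T \<in> CO" and C: "0 \<le> C" "\<And>x. x \<in> H \<Longrightarrow> hnorm (T x) \<le> C * hnorm x" and x: "x \<in> H"
    and V: "V \<noteq> {}"
  shows "hnorm (fejer T n x) \<le> C * hnorm x"
proof (cases "n = 0")
  case True
  then show ?thesis using C by (simp add: fejer_def low_paths_def)
next
  case False
  then have n: "0 < n" by simp
  have Fx: "fejer T n x \<in> H"
    by (rule bop_in[OF conv_ops_bop[OF alg_gen_conv[OF fejer_in_alg_gen[OF V]]] x])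
  let ?t = "\<lambda>j. T (cpull (block n j) id x)"
  have bx: "cpull (block n j) id x \<in> H" for j
    by (rule cpull_in_ell2[OF x]) auto
  show ?thesis
  proof (rule hnorm_boundI(2))
    fix W :: "('v \<times> 'e list) set" assume W: "finite W"
    \<comment> \<open>\<open>J\<close> lies beyond the last window of every path in
      \<open>W\<close>, so the windows below \<open>J\<close> represent the mean on all of
      \<open>W\<close>; the inserted 0 covers an empty \<open>W\<close>.\<close>
    define J where "J = Max (insert 0 ((\<lambda>(v, es). wt es) ` W)) + n"
    have J: "wt es + n \<le> J" if "(v, es) \<in> W" for v es
      unfolding J_def using W that by (auto intro!: Max_ge simp: rev_image_eqI)
    have pt: "(cmod (fejer T n x w))\<^sup>2 \<le> (\<Sum>j<J. (cmod (?t j w))\<^sup>2) / n" if w: "w \<in> W" for w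
    proof (cases "w \<in> P")
      case False
      then show ?thesis using ell2_outside[OF Fx] by (simp add: sum_nonneg)
    next
      case True
      obtain u gs where w_eq: "w = (u, gs)" by fastforce
      have "cmod (fejer T n x w) = cmod (\<Sum>j<J. if w \<in> block n j then ?t j w else 0) / n"
        using fejer_eq_block_average[OF T x True[unfolded w_eq] n J[OF w[unfolded w_eq]]]
        unfolding w_eq by (simp add: norm_divide)
      also have "\<dots> \<le> (\<Sum>j<J. of_bool (w \<in> block n j) * cmod (?t j w)) / n"
        by (intro divide_right_mono sum_norm_le) auto
      finally have "(cmod (fejer T n x w))\<^sup>2 \<le> ((\<Sum>j<J. of_bool (w \<in> block n j) * cmod (?t j w)) / n)\<^sup>2"
        by (intro power_mono) auto
      also have "\<dots> = (\<Sum>j<J. of_bool (w \<in> block n j) * cmod (?t j w))\<^sup>2 / n\<^sup>2"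
        by (simp add: power_divide)
      \<comment> \<open>The indicator is one of the two Cauchy-Schwarz factors: its square sum
        counts the windows containing \<open>w\<close>, at most \<open>n\<close> of them.\<close>
      also have "\<dots> \<le> (\<Sum>j<J. (of_bool (w \<in> block n j))\<^sup>2) * (\<Sum>j<J. (cmod (?t j w))\<^sup>2) / n\<^sup>2"
        by (intro divide_right_mono Cauchy_Schwarz_ineq_sum) auto
      also have "\<dots> \<le> n * (\<Sum>j<J. (cmod (?t j w))\<^sup>2) / n\<^sup>2"
      proof (intro divide_right_mono mult_right_mono)
        have "(\<Sum>j<J. (of_bool (w \<in> block n j))\<^sup>2) = real (card {j. j < J \<and> w \<in> block n j})"
          by (simp add: sum_of_bool_eq Int_def power2_eq_square flip: of_bool_conj)
        then show "(\<Sum>j<J. (of_bool (w \<in> block n j))\<^sup>2) \<le> real n"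
          using card_block_index_le[of J w n] by simp
      qed (auto intro: sum_nonneg)
      also have "\<dots> = (\<Sum>j<J. (cmod (?t j w))\<^sup>2) / n"
        using n by (simp add: power2_eq_square)
      finally show ?thesis .
    qed
    have nb: "(hnorm (cpull (block n j) id x))\<^sup>2 = infsum (\<lambda>p. of_bool (p \<in> block n j) * (cmod (x p))\<^sup>2) UNIV" for j
      unfolding hnorm_power2 by (rule infsum_cong) (auto simp: cpull_def)
    have sb: "(\<lambda>p. of_bool (p \<in> block n j) * (cmod (x p))\<^sup>2) summable_on UNIV" for j
      by (rule summable_on_comparison_test[OF ell2_summable[OF x]]) auto
    have ssb: "((\<lambda>p. \<Sum>j<J. of_bool (p \<in> block n j) * (cmod (x p))\<^sup>2) has_sum
        (\<Sum>j<J. (hnorm (cpull (block n j) id x))\<^sup>2)) UNIV"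
      unfolding nb by (intro has_sum_sum has_sum_infsum sb) simp
    have blocks: "(\<Sum>j<J. (hnorm (cpull (block n j) id x))\<^sup>2) \<le> n * (hnorm x)\<^sup>2"
    proof -
      have "(\<Sum>j<J. (hnorm (cpull (block n j) id x))\<^sup>2) =
          infsum (\<lambda>p. \<Sum>j<J. of_bool (p \<in> block n j) * (cmod (x p))\<^sup>2) UNIV"
        by (rule infsumI[OF ssb, symmetric])
      also have "\<dots> \<le> infsum (\<lambda>p. n * (cmod (x p))\<^sup>2) UNIV"
      proof (rule infsum_mono)
        fix p
        have "(\<Sum>j<J. of_bool (p \<in> block n j) * (cmod (x p))\<^sup>2) =
            real (card {j. j < J \<and> p \<in> block n j}) * (cmod (x p))\<^sup>2"
          by (simp add: sum_of_bool_eq Int_def flip: sum_distrib_right)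
        also have "\<dots> \<le> n * (cmod (x p))\<^sup>2"
          using card_block_index_le[of J p n] by (intro mult_right_mono) auto
        finally show "(\<Sum>j<J. of_bool (p \<in> block n j) * (cmod (x p))\<^sup>2) \<le> n * (cmod (x p))\<^sup>2" .
      qed (rule has_sum_imp_summable[OF ssb], rule summable_on_cmult_right[OF ell2_summable[OF x]])
      also have "\<dots> = n * (hnorm x)\<^sup>2"
        by (simp add: infsum_cmult_right' hnorm_power2)
      finally show ?thesis .
    qed
    have "(\<Sum>w\<in>W. (cmod (fejer T n x w))\<^sup>2) \<le> (\<Sum>w\<in>W. (\<Sum>j<J. (cmod (?t j w))\<^sup>2) / n)"
      by (rule sum_mono) (rule pt)
    also have "\<dots> = (\<Sum>j<J. \<Sum>w\<in>W. (cmod (?t j w))\<^sup>2) / n"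
      by (subst sum.swap) (simp add: sum_divide_distrib)
    also have "\<dots> \<le> (\<Sum>j<J. C\<^sup>2 * (hnorm (cpull (block n j) id x))\<^sup>2) / n"
    proof (intro divide_right_mono sum_mono)
      fix j
      have "(\<Sum>w\<in>W. (cmod (?t j w))\<^sup>2) \<le> (hnorm (?t j))\<^sup>2"
        by (rule sum_le_hnorm_power2[OF bop_in[OF conv_ops_bop[OF T] bx] W])
      also have "\<dots> \<le> (C * hnorm (cpull (block n j) id x))\<^sup>2"
        by (intro power_mono C bx) auto
      finally show "(\<Sum>w\<in>W. (cmod (?t j w))\<^sup>2) \<le> C\<^sup>2 * (hnorm (cpull (block n j) id x))\<^sup>2"
        by (simp add: power_mult_distrib)
    qed auto
    also have "\<dots> = C\<^sup>2 * (\<Sum>j<J. (hnorm (cpull (block n j) id x))\<^sup>2) / n"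
      by (simp add: sum_distrib_left)
    also have "\<dots> \<le> C\<^sup>2 * (n * (hnorm x)\<^sup>2) / n"
      by (intro divide_right_mono mult_left_mono blocks) auto
    also have "\<dots> = (C * hnorm x)\<^sup>2"
      using n by (simp add: power_mult_distrib)
    finally show "(\<Sum>w\<in>W. (cmod (fejer T n x w))\<^sup>2) \<le> (C * hnorm x)\<^sup>2" .
  qed (use C in auto)
qed

lemma fejer_limitin:
  assumes T: "T \<in> CO" and V: "V \<noteq> {}"
  shows "limitin (wot H) (fejer T) T sequentially"
    and "limitin (weak_star_top H) (fejer T) T sequentially"
proof -
  obtain C where C: "0 \<le> C" "\<And>x. x \<in> H \<Longrightarrow> hnorm (T x) \<le> C * hnorm x"
    using bop_bound[OF conv_ops_bop[OF T]] by blast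
  note * = bounded_pointwise_limit[of "fejer T", OF conv_ops_bop[OF alg_gen_conv[OF fejer_in_alg_gen[OF V]]]
      conv_ops_bop[OF T] C(1) fejer_bound[OF T C _ V] fejer_pointwise[OF T]]
  show "limitin (wot H) (fejer T) T sequentially"
    and "limitin (weak_star_top H) (fejer T) T sequentially"
    by (rule *; assumption)+
qed

lemma fsga_eq_conv_ops:
  assumes V: "V \<noteq> {}"
  shows "fsga V E r s = CO"
proof
  show "CO \<subseteq> fsga V E r s"
  proof
    fix T assume T: "T \<in> CO"
    have "limitin (subtopology (wot H) (bop H)) (fejer T) T sequentially"
      unfolding limitin_subtopology
      using fejer_limitin(1)[OF T V] conv_ops_bop[OF T]
        conv_ops_bop[OF alg_gen_conv[OF fejer_in_alg_gen[OF V]]] by auto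
    then show "T \<in> fsga V E r s"
      unfolding fsga_def HG_def
      by (rule limitin_subtopology_closure_of)
        (use fejer_in_alg_gen[OF V] alg_gen_subset_tensor_alg in blast)
  qed
qed (rule fsga_subset_conv_ops)

end

subsection \<open>Weak-* continuous characters and derivations\<close>

context graph
begin

definition wlin where
  "wlin \<delta> \<longleftrightarrow> (\<forall>S\<in>CO. \<forall>T\<in>CO. \<delta> (op_add S T) = \<delta> S + \<delta> T) \<and>
     (\<forall>S\<in>CO. \<forall>c. \<delta> (op_scale c S) = c * \<delta> S) \<and>
     continuous_map (subtopology (weak_star_top H) CO) euclidean (\<delta> :: _ \<Rightarrow> complex)"

definition wchar where
  "wchar \<eta> \<longleftrightarrow> wlin \<eta> \<and> (\<forall>S\<in>CO. \<forall>T\<in>CO. \<eta> (S \<circ> T) = \<eta> S * \<eta> T) \<and> (\<exists>T\<in>CO. \<eta> T \<noteq> 0)"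

text \<open>Equivalently, \<open>T\<close> goes multiplicatively to the upper triangular 2 by 2
  matrix with diagonal \<open>\<eta>' T\<close>, \<open>\<eta> T\<close> and corner
  \<open>\<delta> T\<close>. The left character will belong to the range of an edge, the right one
  to its source.\<close>

definition wder where
  "wder \<eta>' \<eta> \<delta> \<longleftrightarrow> wlin \<delta> \<and> (\<forall>S\<in>CO. \<forall>T\<in>CO. \<delta> (S \<circ> T) = \<eta>' S * \<delta> T + \<delta> S * \<eta> T)"

definition char_at where
  "char_at v \<eta> \<longleftrightarrow> wchar \<eta> \<and> v \<in> V \<and> \<eta> (Q v) = 1"

lemma Lpath_conv: "(v, es) \<in> P \<Longrightarrow> LP v es \<in> CO"
  by (intro alg_gen_conv Lpath_in_alg_gen)

lemma zero_conv: "(\<lambda>x p. 0) \<in> CO"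
  using conv_ops_scale[OF Pop_conv, of 0] by (simp add: op_scale_def)

lemma sum_conv:
  assumes "finite I" "\<And>i. i \<in> I \<Longrightarrow> A i \<in> CO"
  shows "(\<lambda>x p. \<Sum>i\<in>I. c i * A i x p) \<in> CO"
  using assms
proof (induction I rule: finite_induct)
  case (insert i I)
  have "op_add (op_scale (c i) (A i)) (\<lambda>x p. \<Sum>i\<in>I. c i * A i x p) \<in> CO"
    by (intro conv_ops_add conv_ops_scale insert) (use insert in auto)
  then show ?case using insert by (simp add: op_add_def op_scale_def)
qed (simp add: zero_conv)

lemma wlin_zero:
  assumes "wlin \<delta>"
  shows "\<delta> (\<lambda>x p. 0) = 0"
proof -
  have "\<delta> (op_scale 0 (Q undefined)) = 0" using assms Pop_conv by (simp add: wlin_def)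
  then show ?thesis by (simp add: op_scale_def)
qed

lemma wlin_sum:
  assumes d: "wlin \<delta>" and "finite I" "\<And>i. i \<in> I \<Longrightarrow> A i \<in> CO"
  shows "\<delta> (\<lambda>x p. \<Sum>i\<in>I. c i * A i x p) = (\<Sum>i\<in>I. c i * \<delta> (A i))"
  using assms(2,3)
proof (induction I rule: finite_induct)
  case (insert i I)
  let ?R = "\<lambda>x p. \<Sum>i\<in>I. c i * A i x p"
  have "?R \<in> CO" "A i \<in> CO" using insert by (auto intro: sum_conv)
  then have "\<delta> (op_add (op_scale (c i) (A i)) ?R) = c i * \<delta> (A i) + \<delta> ?R"
    using d conv_ops_scale by (simp add: wlin_def)
  then show ?case using insert by (simp add: op_add_def op_scale_def)
qed (simp add: wlin_zero[OF d])

text \<open>On a Fejer mean the functional is a finite sum of multiples of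
  \<open>cf T v es * \<delta> (LP v es)\<close>, and weak-* continuity passes to the limit. The
  disjunction lets each path be killed either by the operator or by the functional.\<close>

lemma wlin_eq_0I:
  assumes d: "wlin \<delta>" and T: "T \<in> CO" and V: "V \<noteq> {}"
    and z: "\<And>v es. (v, es) \<in> P \<Longrightarrow> cf T v es = 0 \<or> \<delta> (LP v es) = 0"
  shows "\<delta> T = 0"
proof -
  have "\<delta> (fejer T n) = 0" for n
  proof -
    have "\<delta> (fejer T n) = (\<Sum>q\<in>low_paths n. (case q of (v, es) \<Rightarrow> of_nat (n - wt es) / of_nat n * cf T v es) *
        \<delta> (case q of (v, es) \<Rightarrow> LP v es))"
      unfolding fejer_def
      by (subst wlin_sum[OF d finite_low_paths, symmetric])
        (auto simp: low_paths_def case_prod_unfold intro: Lpath_conv)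
    also have "\<dots> = 0"
      using z by (intro sum.neutral) (auto simp: low_paths_def)
    finally show ?thesis .
  qed
  moreover have "limitin (subtopology (weak_star_top H) CO) (fejer T) T sequentially"
    unfolding limitin_subtopology
    using fejer_limitin(2)[OF T V] T alg_gen_conv[OF fejer_in_alg_gen[OF V]] by auto
  then have "limitin euclidean (\<delta> \<circ> fejer T) (\<delta> T) sequentially"
    by (rule continuous_map_limit[rotated]) (use d in \<open>simp add: wlin_def\<close>)
  ultimately have "(\<lambda>n. 0) \<longlonglongrightarrow> \<delta> T" by (simp add: o_def)
  then show ?thesis by (simp add: LIMSEQ_const_iff)
qed

section \<open>Basic characters and derivations\<close>

lemma wlin_lincomb:
  assumes "wlin \<alpha>" "wlin \<beta>"
  shows "wlin (\<lambda>T. a * \<alpha> T + b * \<beta> T)"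
proof -
  have "continuous_map (subtopology (weak_star_top H) CO) euclidean (\<lambda>T. a * \<alpha> T + b * \<beta> T)"
    using assms unfolding wlin_def continuous_map_atin limitin_canonical_iff
    by (auto intro!: tendsto_intros)
  then show ?thesis using assms by (simp add: wlin_def algebra_simps)
qed

lemma wder_lincomb:
  assumes "wder \<eta>' \<eta> \<alpha>" "wder \<eta>' \<eta> \<beta>"
  shows "wder \<eta>' \<eta> (\<lambda>T. a * \<alpha> T + b * \<beta> T)"
  using assms wlin_lincomb[of \<alpha> \<beta> a b] by (simp add: wder_def algebra_simps)

lemma wder_zero: "wder \<eta>' \<eta> (\<lambda>T. 0)"
  by (simp add: wder_def wlin_def)

lemma wder_sum:
  assumes "finite F" "\<And>e. e \<in> F \<Longrightarrow> wder \<eta>' \<eta> (\<delta> e)"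
  shows "wder \<eta>' \<eta> (\<lambda>T. \<Sum>e\<in>F. b e * \<delta> e T)"
  using assms
proof (induction F rule: finite_induct)
  case (insert e F)
  then have "wder \<eta>' \<eta> (\<lambda>T. b e * \<delta> e T + 1 * (\<Sum>e\<in>F. b e * \<delta> e T))"
    by (intro wder_lincomb) auto
  then show ?case using insert by simp
qed (simp add: wder_zero)

text \<open>Add and subtract \<open>\<eta>' S * \<eta> T\<close>. Up to scalars this is the corner
  obtained when the diagonal matrix of the two characters is conjugated by a unipotent one.\<close>

lemma wder_inner:
  assumes "wchar \<eta>'" "wchar \<eta>"
  shows "wder \<eta>' \<eta> (\<lambda>T. \<eta>' T - \<eta> T)"
  using assms wlin_lincomb[of \<eta>' \<eta> 1 "-1"] by (simp add: wder_def wchar_def algebra_simps)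

lemma wlin_eval: "(v, es) \<in> P \<Longrightarrow> wlin (\<lambda>T. cf T v es)"
  unfolding wlin_def coef_def op_add_def op_scale_def
  using continuous_map_eval_weak_star[of _ P "(v, es)"] path_end[of v es] by simp

lemma wchar_vertex:
  assumes "v \<in> V"
  shows "char_at v (\<lambda>T. cf T v [])"
proof -
  have p: "(v, []) \<in> P" using assms by simp
  have 1: "cf (Q v) v [] = 1" using cf_Pop[OF p, of v] by simp
  then have "\<exists>T\<in>CO. cf T v [] \<noteq> 0" using Pop_conv[of v] by (metis zero_neq_one)
  then show ?thesis
    unfolding char_at_def wchar_def using 1 assms by (simp add: wlin_eval[OF p] cf_comp[OF _ _ p])
qed

text \<open>A one-edge path has just two cuts, so the product formula for coefficients becomes the
  Leibniz rule.\<close>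

lemma wder_edge:
  assumes "e \<in> E"
  shows "wder (\<lambda>T. cf T (r e) []) (\<lambda>T. cf T (s e) []) (\<lambda>T. cf T (r e) [e])"
proof -
  have p: "(r e, [e]) \<in> P" using assms by simp
  show ?thesis
    unfolding wder_def using wlin_eval[OF p] by (simp add: cf_comp[OF _ _ p])
qed

section \<open>Locating characters at vertices\<close>

lemma Pop_Lop: "e \<in> E \<Longrightarrow> Q (r e) \<circ> L e = L e"
  by (rule bop_ext[of _ P])
    (auto simp: bop_comp Pop_bop Lop_bop Pop_apply Lop_apply bop_in[OF Lop_bop])

lemma Lop_Pop: "e \<in> E \<Longrightarrow> L e \<circ> Q (s e) = L e"
  by (rule bop_ext[of _ P])
    (auto simp: bop_comp Pop_bop Lop_bop Pop_apply Lop_apply bop_in[OF Pop_bop])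

lemma Pop_Pop: "Q u \<circ> Q v = (if u = v then Q v else (\<lambda>x p. 0))"
  by (rule bop_ext[of _ P])
    (auto simp: bop_comp Pop_bop Pop_apply bop_in[OF Pop_bop] conv_ops_bop[OF zero_conv])

lemma wchar_Pop_cases:
  assumes "wchar \<eta>"
  shows "\<eta> (Q u) = 0 \<or> \<eta> (Q u) = 1"
proof -
  have "\<eta> (Q u) = \<eta> (Q u) * \<eta> (Q u)"
    using assms Pop_conv[of u] Pop_Pop[of u u] by (metis wchar_def)
  then show ?thesis by simp
qed

lemma char_at_Pop:
  assumes "char_at v \<eta>"
  shows "\<eta> (Q u) = (if u = v then 1 else 0)"
proof (cases "u = v")
  case False
  have "\<eta> (Q u \<circ> Q v) = \<eta> (Q u) * \<eta> (Q v)"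
    using assms Pop_conv by (simp add: char_at_def wchar_def)
  then have "\<eta> (Q u) = 0"
    using False assms wlin_zero[of \<eta>] by (simp add: Pop_Pop char_at_def wchar_def)
  then show ?thesis using False by simp
qed (use assms in \<open>simp add: char_at_def\<close>)

lemma wchar_Lop:
  assumes "wchar \<eta>" "e \<in> E"
  shows "\<eta> (L e) = \<eta> (Q (r e)) * \<eta> (L e)" "\<eta> (L e) = \<eta> (L e) * \<eta> (Q (s e))"
  using assms Pop_conv Lop_conv[OF assms(2)] Pop_Lop[OF assms(2)] Lop_Pop[OF assms(2)]
  by (metis wchar_def)+

lemma wchar_Lpath_Cons:
  assumes "wchar \<eta>" "(v, e # es) \<in> P"
  shows "\<eta> (LP v (e # es)) = \<eta> (L e) * \<eta> (LP (s e) es)"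
  using assms Lop_conv[of e] Lpath_conv[of "s e" es] by (simp add: wchar_def)

text \<open>A character that kills every \<open>Q v\<close> kills each edge operator by
  \<open>Pop_Lop\<close>, hence each path operator, hence by weak-* continuity everything.
  Continuity takes the place of a finite decomposition of the unit, as there may be infinitely many
  vertices. Uniqueness is orthogonality of the projections.\<close>

lemma wchar_at_unique_vertex:
  assumes c: "wchar \<eta>" and V: "V \<noteq> {}"
  shows "\<exists>!v. char_at v \<eta>"
proof -
  have "\<exists>v\<in>V. \<eta> (Q v) = 1"
  proof (rule ccontr)
    assume "\<not> ?thesis"
    then have z: "\<eta> (Q v) = 0" if "v \<in> V" for v using wchar_Pop_cases[OF c] that by blast
    have "\<eta> (LP v es) = 0" if "(v, es) \<in> P" for v es
    proof (cases es)
      case Nil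
      then show ?thesis using z that by simp
    next
      case (Cons e fs)
      then have "\<eta> (L e) = 0" using wchar_Lop(1)[OF c, of e] z that by simp
      then show ?thesis using wchar_Lpath_Cons[OF c] that Cons by simp
    qed
    then have "\<eta> T = 0" if "T \<in> CO" for T
      using wlin_eq_0I[OF _ that V] c by (simp add: wchar_def)
    then show False using c by (auto simp: wchar_def)
  qed
  then obtain v where v: "char_at v \<eta>" using c by (auto simp: char_at_def)
  moreover have "u = v" if "char_at u \<eta>" for u
    using char_at_Pop[OF v, of u] that by (auto simp: char_at_def split: if_splits)
  ultimately show ?thesis by blast
qed

lemma char_at_Lop:
  assumes "char_at v \<eta>" "e \<in> E" "\<eta> (L e) \<noteq> 0"
  shows "r e = v" "s e = v"
  using wchar_Lop[of \<eta> e] char_at_Pop[OF assms(1)] assms by (auto simp: char_at_def split: if_splits)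

text \<open>A nonzero value on an edge forces the value 1 on the projections at both its ends, and
  multiplicativity extends this to words. Characters at one vertex can thus differ only through
  words in its loops.\<close>

lemma char_at_Lpath:
  assumes c: "char_at v \<eta>" and "(u, es) \<in> P" "\<eta> (LP u es) \<noteq> 0"
  shows "u = v \<and> (\<forall>e\<in>set es. r e = v \<and> s e = v)"
  using assms(2,3)
proof (induction es arbitrary: u)
  case Nil
  then show ?case using char_at_Pop[OF c] by (auto split: if_splits)
next
  case (Cons e es)
  have "wchar \<eta>" using c by (simp add: char_at_def)
  then have "\<eta> (LP u (e # es)) = \<eta> (L e) * \<eta> (LP (s e) es)"
    by (rule wchar_Lpath_Cons[OF _ Cons.prems(1)])
  then have nz: "\<eta> (L e) \<noteq> 0" "\<eta> (LP (s e) es) \<noteq> 0"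
    using Cons.prems(2) by (metis mult_zero_left, metis mult_zero_right)
  have e: "e \<in> E" "r e = u" "(s e, es) \<in> P" using Cons.prems(1) by auto
  show ?case using Cons.IH[OF e(3) nz(2)] char_at_Lop[OF c e(1) nz(1)] e(2) by simp
qed

lemma vend_loops: "(\<forall>e\<in>set es. s e = v) \<Longrightarrow> vend s v es = v"
  by (induction es) auto

text \<open>Restricting coefficients to words in the loops at \<open>v\<close> is multiplicative, so an idempotent
  yields an idempotent noncommutative power series, which has to be constant.\<close>

lemma idempotent_loop_coef:
  assumes p: "p \<in> CO" "p \<circ> p = p" and v: "v \<in> V"
    and "(v, es) \<in> P" "\<forall>e\<in>set es. r e = v \<and> s e = v" "es \<noteq> []"
  shows "cf p v es = 0"
  using assms(4-)
proof (induction "length es" arbitrary: es rule: less_induct)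
  case less
  let ?c = "cf p v"
  have ve: "vend s v (take k es) = v" for k
    using less.prems(2) by (intro vend_loops) (auto dest: in_set_takeD)
  have pd: "(v, drop k es) \<in> P" for k using path_drop[OF less.prems(1), of k] ve by simp
  \<comment> \<open>At an interior cut the left factor is a shorter nonempty loop word, so the
    induction hypothesis applies.\<close>
  have mid: "?c (take k es) * ?c (drop k es) = 0" if "k \<le> length es" "k \<noteq> 0" "k \<noteq> length es" for k
    using that less.prems less.hyps[of "take k es", OF _ path_take]
    by (auto dest: in_set_takeD)
  have "?c es = (\<Sum>k\<le>length es. ?c (take k es) * ?c (drop k es))"
    using cf_comp[OF p(1) p(1) less.prems(1)] ve by (simp add: p(2))
  also have "\<dots> = (\<Sum>k\<in>{0, length es}. ?c (take k es) * ?c (drop k es))"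
    using mid by (intro sum.mono_neutral_right) auto
  also have "\<dots> = 2 * ?c [] * ?c es"
    using less.prems(3) by simp
  \<comment> \<open>Once \<open>?c []\<close> is known to be 0 or 1, the factor
    \<open>1 - 2 * ?c []\<close> is 1 or -1 and can be cancelled.\<close>
  finally have 1: "?c es = 2 * ?c [] * ?c es" .
  have "?c [] = ?c [] * ?c []"
    using cf_comp[OF p(1) p(1), of v "[]"] v by (simp add: p(2))
  then have "?c [] = 0 \<or> ?c [] = 1" by simp
  then show ?case using 1 by auto
qed

lemma char_at_idempotent:
  assumes c: "char_at v \<eta>" and p: "p \<in> CO" "p \<circ> p = p"
  shows "\<eta> p = cf p v []"
proof -
  have v: "v \<in> V" and lin: "wlin \<eta>" using c by (auto simp: char_at_def wchar_def)
  \<comment> \<open>Subtracting the constant coefficient leaves no coefficient on any loop word at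
    \<open>v\<close>, the empty word included, and other paths are killed by
    \<open>\<eta>\<close>.\<close>
  let ?T = "op_add p (op_scale (- cf p v []) (Q v))"
  have T: "?T \<in> CO" by (intro conv_ops_add conv_ops_scale p Pop_conv)
  have "\<eta> ?T = 0"
  proof (rule wlin_eq_0I[OF lin T])
    fix u es assume pe: "(u, es) \<in> P"
    show "cf ?T u es = 0 \<or> \<eta> (LP u es) = 0"
    proof (cases "\<eta> (LP u es) = 0")
      case False
      then have u: "u = v" "\<forall>e\<in>set es. r e = v \<and> s e = v" using char_at_Lpath[OF c pe] by auto
      have "cf ?T u es = cf p v es - cf p v [] * (if es = [] then 1 else 0)"
        using cf_Pop[OF pe, of v] u by (simp add: cf_op_add cf_op_scale)
      also have "\<dots> = 0"
        using idempotent_loop_coef[OF p v _ u(2)] pe u by auto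
      finally show ?thesis by simp
    qed simp
  qed (use v in auto)
  moreover have "\<eta> ?T = \<eta> p - cf p v [] * \<eta> (Q v)"
    using lin p conv_ops_scale[OF Pop_conv] Pop_conv by (simp add: wlin_def)
  ultimately show ?thesis using char_at_Pop[OF c, of v] by simp
qed

text \<open>The Leibniz rule carries vanishing from generators to path operators, and continuity
  carries it further. Multiplying an edge operator by the projections at its ends kills the
  derivation on all edges other than those from \<open>v\<close> to \<open>w\<close>, so only these
  and \<open>Q v\<close> remain as data.\<close>

lemma wder_eq_0:
  assumes c: "char_at v \<eta>" and c': "char_at w \<eta>'" and d: "wder \<eta>' \<eta> \<delta>"
    and Qv: "\<delta> (Q v) = 0" and Le: "\<And>e. e \<in> E \<Longrightarrow> r e = w \<Longrightarrow> s e = v \<Longrightarrow> \<delta> (L e) = 0"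
    and T: "T \<in> CO"
  shows "\<delta> T = 0"
proof -
  have lin: "wlin \<delta>" and der: "\<And>S T. S \<in> CO \<Longrightarrow> T \<in> CO \<Longrightarrow> \<delta> (S \<circ> T) = \<eta>' S * \<delta> T + \<delta> S * \<eta> T"
    using d by (auto simp: wder_def)
  have Q0: "\<delta> (Q u) = 0" for u
  proof -
    consider "u = v" | "u \<noteq> v" "u = w" | "u \<noteq> v" "u \<noteq> w" by blast
    then show ?thesis
    proof cases
      \<comment> \<open>Since \<open>Q w \<circ> Q v\<close> is zero, the Leibniz rule gives
        opposite values at \<open>Q w\<close> and \<open>Q v\<close>.\<close>
      case 2
      then show ?thesis
        using der[OF Pop_conv Pop_conv, of u v] Qv wlin_zero[OF lin]
        by (simp add: Pop_Pop char_at_Pop[OF c] char_at_Pop[OF c'])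
    next
      case 3
      then show ?thesis
        using der[OF Pop_conv Pop_conv, of u u]
        by (simp add: Pop_Pop char_at_Pop[OF c] char_at_Pop[OF c'])
    qed (use Qv in simp)
  qed
  have L0: "\<delta> (L e) = 0" if e: "e \<in> E" for e
    using der[OF Pop_conv Lop_conv[OF e], of "r e"] der[OF Lop_conv[OF e] Pop_conv, of "s e"] Le[OF e]
    by (auto simp: Pop_Lop[OF e] Lop_Pop[OF e] Q0 char_at_Pop[OF c] char_at_Pop[OF c'] split: if_splits)
  have "\<delta> (LP u es) = 0" if "(u, es) \<in> P" for u es
    using that
  proof (induction es arbitrary: u)
    case (Cons e es)
    then have e: "e \<in> E" "(s e, es) \<in> P" by auto
    then show ?case using der[OF Lop_conv[OF e(1)] Lpath_conv[OF e(2)]] Cons.IH L0 by (simp add: o_def)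
  qed (simp add: Q0)
  then show ?thesis
    using wlin_eq_0I[OF lin T] c by (auto simp: char_at_def)
qed

end

subsection \<open>Recovering the graph\<close>

text \<open>Gaussian elimination: choose a pivot \<open>e0\<close> for the equation
  \<open>f\<close>, eliminate it from the other equations, solve the smaller system, and let the
  coefficient at the pivot absorb \<open>f\<close>.\<close>

lemma underdetermined_system:
  fixes M :: "'a \<Rightarrow> 'b \<Rightarrow> 'k::field"
  assumes "finite N" "finite F" "card N < card F"
  shows "\<exists>b. (\<exists>e\<in>F. b e \<noteq> 0) \<and> (\<forall>f\<in>N. (\<Sum>e\<in>F. b e * M e f) = 0)"
  using assms
proof (induction N arbitrary: F M rule: finite_induct)
  case empty
  then obtain e where "e \<in> F" by (auto simp: card_gt_0_iff)
  then show ?case by (intro exI[of _ "\<lambda>_. 1"]) auto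
next
  case (insert f N)
  show ?case
  proof (cases "\<forall>e\<in>F. M e f = 0")
    case True
    obtain b where b: "\<exists>e\<in>F. b e \<noteq> 0" "\<forall>f\<in>N. (\<Sum>e\<in>F. b e * M e f) = 0"
      using insert.IH[of F M] insert.prems insert.hyps by auto
    then show ?thesis using True by (intro exI[of _ b]) auto
  next
    case False
    then obtain e0 where e0: "e0 \<in> F" "M e0 f \<noteq> 0" by blast
    let ?M = "\<lambda>e g. M e g - M e f / M e0 f * M e0 g"
    have "card N < card (F - {e0})" using insert.prems insert.hyps e0 by simp
    then obtain b where b: "\<exists>e\<in>F - {e0}. b e \<noteq> 0" "\<forall>g\<in>N. (\<Sum>e\<in>F - {e0}. b e * ?M e g) = 0"
      using insert.IH[of "F - {e0}" ?M] insert.prems(1) by blast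
    let ?b = "b(e0 := - (\<Sum>e\<in>F - {e0}. b e * M e f / M e0 f))"
    have *: "(\<Sum>e\<in>F. ?b e * M e g) = (\<Sum>e\<in>F - {e0}. b e * ?M e g)" for g
    proof -
      have "(\<Sum>e\<in>F. ?b e * M e g) = ?b e0 * M e0 g + (\<Sum>e\<in>F - {e0}. ?b e * M e g)"
        using insert.prems e0 by (simp add: sum.remove)
      also have "(\<Sum>e\<in>F - {e0}. ?b e * M e g) = (\<Sum>e\<in>F - {e0}. b e * M e g)"
        by (rule sum.cong) auto
      also have "?b e0 * M e0 g = - (\<Sum>e\<in>F - {e0}. b e * (M e f / M e0 f * M e0 g))"
        by (simp add: sum_distrib_right mult.assoc)
      finally show ?thesis by (simp add: sum_subtractf right_diff_distrib)
    qed
    have "(\<Sum>e\<in>F. ?b e * M e f) = 0" unfolding * using e0 by simp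
    moreover have "\<forall>g\<in>N. (\<Sum>e\<in>F. ?b e * M e g) = 0" unfolding * using b by blast
    moreover have "\<exists>e\<in>F. ?b e \<noteq> 0" using b(1) by auto
    ultimately show ?thesis by (intro exI[of _ ?b]) blast
  qed
qed

lemma finite_if_card_subset_le:
  assumes "\<And>F. F \<subseteq> A \<Longrightarrow> finite F \<Longrightarrow> card F \<le> n"
  shows "finite A"
proof (rule ccontr)
  assume "infinite A"
  then obtain F where "finite F" "card F = Suc n" "F \<subseteq> A"
    using infinite_arbitrarily_large by blast
  then show False using assms[of F] by simp
qed

text \<open>Finiteness passes from either set to the other by bounding finite subsets, and two
  infinite countable sets are in bijection. The bounds are conditional on a finite opposite set
  because the edge count works with one linear equation per opposite edge.\<close>

lemma countable_bij_betwI: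
  assumes "countable A" "countable B"
    and "\<And>F. finite B \<Longrightarrow> F \<subseteq> A \<Longrightarrow> finite F \<Longrightarrow> card F \<le> card B"
    and "\<And>F. finite A \<Longrightarrow> F \<subseteq> B \<Longrightarrow> finite F \<Longrightarrow> card F \<le> card A"
  shows "\<exists>h. bij_betw h A B"
proof (cases "finite A")
  case True
  then have B: "finite B" using finite_if_card_subset_le[OF assms(4)] by simp
  have "card A = card B" using assms(3)[OF B subset_refl True] assms(4)[OF True subset_refl B] by simp
  then show ?thesis by (rule finite_same_card_bij[OF True B])
next
  case False
  have "infinite B" using finite_if_card_subset_le[OF assms(3)] False by auto
  obtain f where "bij_betw f A (UNIV :: nat set)" using countableE_infinite[OF assms(1) False] by blast
  moreover obtain g where "bij_betw g B (UNIV :: nat set)"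
    using countableE_infinite[OF assms(2) \<open>infinite B\<close>] by blast
  ultimately show ?thesis using bij_betw_trans[OF _ bij_betw_inv_into] by blast
qed

text \<open>\<open>\<sigma>\<close> runs from the second algebra to the first so that functionals on
  the first pull back to the second; surjectivity keeps a pulled-back character nonzero. Recording
  one direction only lets the inverse be a second instance.\<close>

locale hom_pair = G: graph V E r s + G': graph V' E' r' s'
  for V :: "'v set" and E :: "'e set" and r s :: "'e \<Rightarrow> 'v"
    and V' :: "'w set" and E' :: "'f set" and r' s' :: "'f \<Rightarrow> 'w" +
  fixes \<sigma>
  assumes \<sigma>_in: "X \<in> G'.CO \<Longrightarrow> \<sigma> X \<in> G.CO"
    and \<sigma>_add: "X \<in> G'.CO \<Longrightarrow> Y \<in> G'.CO \<Longrightarrow> \<sigma> (op_add X Y) = op_add (\<sigma> X) (\<sigma> Y)"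
    and \<sigma>_comp: "X \<in> G'.CO \<Longrightarrow> Y \<in> G'.CO \<Longrightarrow> \<sigma> (X \<circ> Y) = \<sigma> X \<circ> \<sigma> Y"
    and \<sigma>_scale: "X \<in> G'.CO \<Longrightarrow> \<sigma> (op_scale c X) = op_scale c (\<sigma> X)"
    and \<sigma>_cont: "continuous_map (subtopology (weak_star_top G'.H) G'.CO)
        (subtopology (weak_star_top G.H) G.CO) \<sigma>"
    and \<sigma>_surj: "Z \<in> G.CO \<Longrightarrow> \<exists>X\<in>G'.CO. \<sigma> X = Z"
    and nonempty: "V \<noteq> {}" "V' \<noteq> {}"
begin

lemma wlin_pull: "G.wlin \<delta> \<Longrightarrow> G'.wlin (\<lambda>T. \<delta> (\<sigma> T))"
  using continuous_map_compose[OF \<sigma>_cont, of euclidean \<delta>]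
  by (simp add: G.wlin_def G'.wlin_def \<sigma>_in \<sigma>_add \<sigma>_scale o_def)

lemma wchar_pull: "G.wchar \<delta> \<Longrightarrow> G'.wchar (\<lambda>T. \<delta> (\<sigma> T))"
  using wlin_pull[of \<delta>] \<sigma>_surj
  by (simp add: G.wchar_def G'.wchar_def \<sigma>_in \<sigma>_comp) metis

lemma wder_pull: "G.wder \<eta>' \<eta> \<delta> \<Longrightarrow> G'.wder (\<lambda>T. \<eta>' (\<sigma> T)) (\<lambda>T. \<eta> (\<sigma> T)) (\<lambda>T. \<delta> (\<sigma> T))"
  using wlin_pull[of \<delta>] by (simp add: G.wder_def G'.wder_def \<sigma>_in \<sigma>_comp)

definition vrel :: "'v \<Rightarrow> 'w \<Rightarrow> bool" where
  "vrel v v' \<longleftrightarrow> v \<in> V \<and> v' \<in> V' \<and> G'.char_at v' (\<lambda>T. G.cf (\<sigma> T) v [])"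

lemma vrel_ex1: "v \<in> V \<Longrightarrow> \<exists>!v'. vrel v v'"
proof -
  assume v: "v \<in> V"
  have "G'.wchar (\<lambda>T. G.cf (\<sigma> T) v [])"
    by (rule wchar_pull) (use G.wchar_vertex[OF v] in \<open>simp add: G.char_at_def\<close>)
  from G'.wchar_at_unique_vertex[OF this nonempty(2)]
  show ?thesis using v by (auto simp: vrel_def G'.char_at_def)
qed

end

locale iso_pair = hom_pair V E r s V' E' r' s' \<sigma> + bk: hom_pair V' E' r' s' V E r s \<tau>
  for V :: "'v set" and E :: "'e set" and r s :: "'e \<Rightarrow> 'v"
    and V' :: "'w set" and E' :: "'f set" and r' s' :: "'f \<Rightarrow> 'w" and \<sigma> \<tau> +
  assumes \<sigma>\<tau>: "X \<in> G.CO \<Longrightarrow> \<sigma> (\<tau> X) = X" and \<tau>\<sigma>: "Y \<in> G'.CO \<Longrightarrow> \<tau> (\<sigma> Y) = Y"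
begin

lemma swap: "iso_pair V' E' r' s' V E r s \<tau> \<sigma>"
  using \<sigma>\<tau> \<tau>\<sigma> by unfold_locales

text \<open>The pullback of the vertex character at \<open>v\<close> and the vertex character at
  \<open>v'\<close> both sit at \<open>v'\<close>, so they agree on the idempotent
  \<open>\<tau> (G.Q u)\<close>, where \<open>u\<close> is the vertex reached on the way back. The
  latter is 1 there by choice of \<open>u\<close>; the former is 1 only if
  \<open>u = v\<close>.\<close>

lemma vrel_imp_back:
  assumes "vrel v v'"
  shows "bk.vrel v' v"
proof -
  have v: "v \<in> V" "v' \<in> V'" and c: "G'.char_at v' (\<lambda>T. G.cf (\<sigma> T) v [])"
    using assms by (auto simp: vrel_def)
  obtain u where u: "bk.vrel v' u" using bk.vrel_ex1[OF v(2)] by blast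
  then have uV: "u \<in> V" and qu: "G'.cf (\<tau> (G.Q u)) v' [] = 1"
    by (auto simp: bk.vrel_def G.char_at_def)
  have q: "\<tau> (G.Q u) \<in> G'.CO" by (rule bk.\<sigma>_in[OF G.Pop_conv])
  have "\<tau> (G.Q u) \<circ> \<tau> (G.Q u) = \<tau> (G.Q u)"
    using bk.\<sigma>_comp[OF G.Pop_conv G.Pop_conv, of u u] by (simp add: G.Pop_Pop)
  from G'.char_at_idempotent[OF c q this] qu
  have "G.cf (G.Q u) v [] = 1" by (simp add: \<sigma>\<tau> G.Pop_conv)
  then have "u = v" using G.cf_Pop[of v "[]" u] v by (simp split: if_splits)
  then show ?thesis using u by simp
qed

text \<open>With more edges than the target has, a nontrivial combination of transported edge
  derivations vanishes on all target edges. An inner correction makes it vanish at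
  \<open>G'.Q v'\<close> too, so it is zero; yet at \<open>\<tau> (G.L e0)\<close> its value is the
  coefficient of \<open>e0\<close>.\<close>

lemma edges_card_le:
  assumes v: "vrel v v'" and w: "vrel w w'"
    and fin: "finite {f \<in> E'. r' f = w' \<and> s' f = v'}"
    and F: "F \<subseteq> {e \<in> E. r e = w \<and> s e = v}" "finite F"
  shows "card F \<le> card {f \<in> E'. r' f = w' \<and> s' f = v'}"
proof (rule ccontr)
  let ?N = "{f \<in> E'. r' f = w' \<and> s' f = v'}"
  assume "\<not> card F \<le> card ?N"
  then have "card ?N < card F" by simp
  let ?d = "\<lambda>e T. G.cf (\<sigma> T) (r e) [e]"
  let ?\<eta> = "\<lambda>T. G.cf (\<sigma> T) v []" and ?\<eta>' = "\<lambda>T. G.cf (\<sigma> T) w []"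
  obtain b where b: "\<exists>e\<in>F. b e \<noteq> 0" "\<forall>f\<in>?N. (\<Sum>e\<in>F. b e * ?d e (G'.L f)) = 0"
    using underdetermined_system[OF fin F(2) \<open>card ?N < card F\<close>, of "\<lambda>e f. ?d e (G'.L f)"] by blast
  have c: "G'.char_at v' ?\<eta>" and c': "G'.char_at w' ?\<eta>'"
    using v w by (auto simp: vrel_def)
  have "G'.wder ?\<eta>' ?\<eta> (?d e)" if "e \<in> F" for e
    using wder_pull[OF G.wder_edge[of e]] F that by auto
  then have d: "G'.wder ?\<eta>' ?\<eta> (\<lambda>T. \<Sum>e\<in>F. b e * ?d e T)" (is "G'.wder _ _ ?s")
    by (rule G'.wder_sum[OF F(2)])
  \<comment> \<open>For \<open>v' \<noteq> w'\<close> the inner derivation has the value 0 - 1 at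
    \<open>G'.Q v'\<close>, so this \<open>k\<close> cancels \<open>?s\<close> there. For
    \<open>v' = w'\<close> it vanishes at \<open>G'.Q v'\<close> and could correct nothing.\<close>
  define k where "k = (if v' = w' then 0 else ?s (G'.Q v'))"
  have d': "G'.wder ?\<eta>' ?\<eta> (\<lambda>T. 1 * ?s T + k * (?\<eta>' T - ?\<eta> T))" (is "G'.wder _ _ ?t")
    by (rule G'.wder_lincomb[OF d G'.wder_inner]) (use c c' in \<open>auto simp: G'.char_at_def\<close>)
  have t0: "?t T = 0" if "T \<in> G'.CO" for T
  proof (rule G'.wder_eq_0[OF c c' d' _ _ that])
    show "?t (G'.Q v') = 0"
    proof (cases "v' = w'")
      case True
      \<comment> \<open>Both characters are 1 here, so the value of \<open>?s\<close> at the
        idempotent equals twice itself.\<close>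
      have "?s (G'.Q v' \<circ> G'.Q v') = ?\<eta>' (G'.Q v') * ?s (G'.Q v') + ?s (G'.Q v') * ?\<eta> (G'.Q v')"
        using d G'.Pop_conv[of v'] by (simp add: G'.wder_def)
      then have "?s (G'.Q v') = 0"
        using True by (simp add: G'.Pop_Pop G'.char_at_Pop[OF c] G'.char_at_Pop[OF c'])
      then show ?thesis using True by (simp add: k_def)
    next
      case False
      then show ?thesis
        by (simp add: k_def G'.char_at_Pop[OF c] G'.char_at_Pop[OF c'])
    qed
    fix f assume f: "f \<in> E'" "r' f = w'" "s' f = v'"
    have "?s (G'.L f) = 0" using b(2) f by blast
    moreover have "k * (?\<eta>' (G'.L f) - ?\<eta> (G'.L f)) = 0"
    proof (cases "v' = w'")
      case False
      \<comment> \<open>\<open>f\<close> is not a loop, so the inner correction leaves the vanishing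
        on edges intact.\<close>
      then have "?\<eta> (G'.L f) = 0" "?\<eta>' (G'.L f) = 0"
        using G'.char_at_Lop[OF c f(1)] G'.char_at_Lop[OF c' f(1)] f by blast+
      then show ?thesis by simp
    qed (simp add: k_def)
    ultimately show "?t (G'.L f) = 0" by simp
  qed
  obtain e0 where e0: "e0 \<in> F" "b e0 \<noteq> 0" using b(1) by blast
  have e0E: "e0 \<in> E" using e0 F by auto
  have vw: "v \<in> V" "w \<in> V" using v w by (auto simp: vrel_def)
  let ?T = "\<tau> (G.L e0)"
  have T: "?T \<in> G'.CO" by (rule bk.\<sigma>_in[OF G.Lop_conv[OF e0E]])
  have [simp]: "\<sigma> ?T = G.L e0" by (rule \<sigma>\<tau>[OF G.Lop_conv[OF e0E]])
  \<comment> \<open>An edge operator has no coefficient on empty paths, so the inner correction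
    drops out at \<open>?T\<close>.\<close>
  have "?\<eta>' ?T = 0" "?\<eta> ?T = 0"
    using vw by (simp_all add: G.cf_Lop)
  moreover have "?s ?T = (\<Sum>e\<in>F. if e = e0 then b e else 0)"
    using F by (intro sum.cong) (auto simp: G.cf_Lop)
  then have "?s ?T = b e0" using F e0 by simp
  ultimately show False using t0[OF T] e0 by simp
qed

lemma graph_isoI: "graph_iso V E r s V' E' r' s'"
proof -
  interpret sw: iso_pair V' E' r' s' V E r s \<tau> \<sigma> by (rule swap)
  have iff: "vrel v v' \<longleftrightarrow> bk.vrel v' v" for v v'
    using vrel_imp_back sw.vrel_imp_back by blast
  define \<phi> where "\<phi> = (\<lambda>v. THE v'. vrel v v')"
  have \<phi>: "vrel v (\<phi> v)" if "v \<in> V" for v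
    unfolding \<phi>_def by (rule theI'[OF vrel_ex1[OF that]])
  have \<phi>_bij: "bij_betw \<phi> V V'"
  proof (rule bij_betw_imageI)
    show "inj_on \<phi> V"
      using \<phi> bk.vrel_ex1 iff by (metis inj_onI vrel_def)
    show "\<phi> ` V = V'"
    proof
      show "\<phi> ` V \<subseteq> V'" using \<phi> by (auto simp: vrel_def)
      show "V' \<subseteq> \<phi> ` V"
      proof
        fix v' assume "v' \<in> V'"
        then obtain v where v: "vrel v v'" using bk.vrel_ex1 iff by blast
        then have vV: "v \<in> V" by (simp add: vrel_def)
        then have "\<phi> v = v'" using vrel_ex1[OF vV] \<phi>[OF vV] v by blast
        then show "v' \<in> \<phi> ` V" using vV by blast
      qed
    qed
  qed
  let ?N = "\<lambda>w v. {e \<in> E. r e = w \<and> s e = v}" and ?N' = "\<lambda>w v. {e \<in> E'. r' e = w \<and> s' e = v}"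
  have ex: "\<exists>h. bij_betw h (?N w v) (?N' (\<phi> w) (\<phi> v))" if "w \<in> V" "v \<in> V" for w v
  proof (rule countable_bij_betwI)
    show "countable (?N w v)" "countable (?N' (\<phi> w) (\<phi> v))"
      using G.graph G'.graph by (auto simp: countable_graph_def intro: countable_subset)
    show "card F \<le> card (?N' (\<phi> w) (\<phi> v))"
      if "finite (?N' (\<phi> w) (\<phi> v))" "F \<subseteq> ?N w v" "finite F" for F
      using edges_card_le[OF \<phi> \<phi>] that \<open>w \<in> V\<close> \<open>v \<in> V\<close> by blast
    show "card F \<le> card (?N w v)"
      if "finite (?N w v)" "F \<subseteq> ?N' (\<phi> w) (\<phi> v)" "finite F" for F
      using sw.edges_card_le[of "\<phi> v" v "\<phi> w" w F] that \<phi>[OF \<open>w \<in> V\<close>] \<phi>[OF \<open>v \<in> V\<close>] iff by blast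
  qed
  \<comment> \<open>One bijection per ordered pair of vertices; the edge sets with fixed range and
    source partition \<open>E\<close>, so the pieces glue.\<close>
  define h where "h = (\<lambda>w v. SOME h. bij_betw h (?N w v) (?N' (\<phi> w) (\<phi> v)))"
  have h: "bij_betw (h w v) (?N w v) (?N' (\<phi> w) (\<phi> v))" if "w \<in> V" "v \<in> V" for w v
    unfolding h_def by (rule someI_ex[OF ex[OF that]])
  define \<psi> where "\<psi> = (\<lambda>e. h (r e) (s e) e)"
  have \<psi>: "\<psi> e \<in> ?N' (\<phi> (r e)) (\<phi> (s e))" if "e \<in> E" for e
    using bij_betw_apply[OF h[of "r e" "s e"], of e] that by (simp add: \<psi>_def)
  have "bij_betw \<psi> E E'"
  proof (rule bij_betw_imageI)
    show "inj_on \<psi> E"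
    proof (rule inj_onI)
      fix e f assume e: "e \<in> E" and f: "f \<in> E" and eq: "\<psi> e = \<psi> f"
      have "\<phi> (r e) = \<phi> (r f)" "\<phi> (s e) = \<phi> (s f)" using \<psi>[OF e] \<psi>[OF f] eq by auto
      then have rs: "r e = r f" "s e = s f"
        using \<phi>_bij e f by (auto simp: bij_betw_def dest: inj_onD)
      have "inj_on (h (r e) (s e)) (?N (r e) (s e))"
        using h[of "r e" "s e"] e by (simp add: bij_betw_def)
      then show "e = f" using eq rs e f by (auto simp: \<psi>_def dest: inj_onD)
    qed
    show "\<psi> ` E = E'"
    proof
      show "\<psi> ` E \<subseteq> E'" using \<psi> by auto
      show "E' \<subseteq> \<psi> ` E"
      proof
        fix f assume f: "f \<in> E'"
        obtain w v where wv: "w \<in> V" "v \<in> V" "r' f = \<phi> w" "s' f = \<phi> v"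
          using \<phi>_bij f by (metis bij_betw_imp_surj_on G'.range_in_V G'.source_in_V imageE)
        then have "f \<in> h w v ` ?N w v" using h[of w v] f by (auto simp: bij_betw_def)
        then obtain e where "e \<in> ?N w v" "f = h w v e" by blast
        then show "f \<in> \<psi> ` E" by (auto simp: \<psi>_def)
      qed
    qed
  qed
  then show ?thesis
    unfolding graph_iso_def using \<phi>_bij \<psi> by (intro exI[of _ \<phi>] exI[of _ \<psi>]) auto
qed

end

subsection \<open>Unitary conjugation\<close>

text \<open>Conjugation of \<open>X\<close> by the unitary \<open>cpull P' g\<close>, whose adjoint
  is \<open>cpull P h\<close>, when \<open>g\<close> and \<open>h\<close> are inverse bijections of
  the index sets. The zero branch matters: a function outside \<open>ell2 P'\<close> may still pull
  back into \<open>ell2 P\<close>, while members of \<open>bop\<close> vanish off their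
  space.\<close>

definition conj_op where
  "conj_op P P' h g X = (\<lambda>y. if y \<in> ell2 P' then cpull P' g (X (cpull P h y)) else (\<lambda>p. 0))"

locale index_bij =
  fixes P :: "'p set" and P' :: "'q set" and h :: "'p \<Rightarrow> 'q" and g :: "'q \<Rightarrow> 'p"
  assumes h_in: "p \<in> P \<Longrightarrow> h p \<in> P'" and g_in: "q \<in> P' \<Longrightarrow> g q \<in> P"
    and gh: "p \<in> P \<Longrightarrow> g (h p) = p" and hg: "q \<in> P' \<Longrightarrow> h (g q) = q"
begin

lemma inj_h: "inj_on h P" by (rule inj_on_inverseI[of P g h]) (rule gh)

lemma inj_g: "inj_on g P'" by (rule inj_on_inverseI[of P' h g]) (rule hg)

lemma pull_in: "y \<in> ell2 P' \<Longrightarrow> cpull P h y \<in> ell2 P"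
  by (rule cpull_in_ell2[OF _ inj_h])

lemma push_in: "x \<in> ell2 P \<Longrightarrow> cpull P' g x \<in> ell2 P'"
  by (rule cpull_in_ell2[OF _ inj_g])

lemma pull_push: "x \<in> ell2 P \<Longrightarrow> cpull P h (cpull P' g x) = x"
  by (rule ext) (auto simp: cpull_def h_in gh ell2_outside)

lemma iprod_push:
  assumes "x \<in> ell2 P"
  shows "iprod (cpull P' g x) y = iprod x (cpull P h y)"
proof -
  have "iprod (cpull P' g x) y = infsum (\<lambda>q. x (g q) * cnj (y q)) P'"
    unfolding iprod_def by (rule infsum_cong_neutral) (auto simp: cpull_def)
  also have "\<dots> = infsum (\<lambda>p. x (g (h p)) * cnj (y (h p))) P"
    by (rule infsum_reindex_bij_betw[symmetric])
      (rule bij_betw_byWitness[where f' = g], use h_in g_in gh hg in auto)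
  also have "\<dots> = iprod x (cpull P h y)"
    unfolding iprod_def by (rule infsum_cong_neutral) (auto simp: cpull_def gh)
  finally show ?thesis .
qed

abbreviation "cj \<equiv> conj_op P P' h g"

lemma conj_op_apply: "y \<in> ell2 P' \<Longrightarrow> q \<in> P' \<Longrightarrow> cj X y q = X (cpull P h y) (g q)"
  by (simp add: conj_op_def cpull_def)

lemma conj_op_bop:
  assumes X: "X \<in> bop (ell2 P)"
  shows "cj X \<in> bop (ell2 P')"
proof -
  obtain C where C: "0 \<le> C" "\<And>x. x \<in> ell2 P \<Longrightarrow> hnorm (X x) \<le> C * hnorm x"
    using bop_bound[OF X] by blast
  show ?thesis
  proof (rule bopI[where C = C])
    fix y assume y: "y \<in> ell2 P'"
    note py = pull_in[OF y]
    show "cj X y \<in> ell2 P'" using push_in[OF bop_in[OF X py]] y by (simp add: conj_op_def)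
    have "hnorm (cj X y) \<le> hnorm (X (cpull P h y))"
      using cpull_bound(2)[OF bop_in[OF X py] inj_g] y by (simp add: conj_op_def)
    also have "\<dots> \<le> C * hnorm (cpull P h y)" by (rule C(2)[OF py])
    also have "\<dots> \<le> C * hnorm y" by (intro mult_left_mono cpull_bound(2)[OF y inj_h] C)
    finally show "hnorm (cj X y) \<le> C * hnorm y" .
  next
    fix y z a b assume y: "y \<in> ell2 P'" and z: "z \<in> ell2 P'"
    show "cj X (\<lambda>p. a * y p + b * z p) = (\<lambda>p. a * cj X y p + b * cj X z p)"
      using bop_lincomb[OF X pull_in[OF y] pull_in[OF z]] y z
      by (simp add: conj_op_def ell2_lincomb cpull_lincomb)
  qed (simp add: conj_op_def)
qed

lemma conj_op_add: "cj (op_add X Y) = op_add (cj X) (cj Y)"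
  by (intro ext) (simp add: conj_op_def op_add_def cpull_def)

lemma conj_op_scale: "cj (op_scale c X) = op_scale c (cj X)"
  by (intro ext) (simp add: conj_op_def op_scale_def cpull_def)

lemma conj_op_comp:
  assumes X: "X \<in> bop (ell2 P)" and Y: "Y \<in> bop (ell2 P)"
  shows "cj (X \<circ> Y) = cj X \<circ> cj Y"
proof
  fix y
  show "cj (X \<circ> Y) y = (cj X \<circ> cj Y) y"
  proof (cases "y \<in> ell2 P'")
    case True
    have "Y (cpull P h y) \<in> ell2 P" by (rule bop_in[OF Y pull_in[OF True]])
    then show ?thesis using True push_in pull_push by (simp add: conj_op_def)
  next
    case False
    then show ?thesis using bop_zero[OF conj_op_bop[OF X]] by (simp add: conj_op_def[of _ _ _ _ Y] conj_op_def[of _ _ _ _ "X \<circ> Y"])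
  qed
qed

lemma conj_op_inverse:
  assumes X: "X \<in> bop (ell2 P)"
  shows "conj_op P' P g h (cj X) = X"
proof
  fix x
  show "conj_op P' P g h (cj X) x = X x"
  proof (cases "x \<in> ell2 P")
    case True
    then show ?thesis using bop_in[OF X True] push_in pull_push by (simp add: conj_op_def)
  next
    case False
    then show ?thesis using bop_outside[OF X] by (simp add: conj_op_def)
  qed
qed

text \<open>A sigma-weak functional at \<open>cj X\<close> is the one with pulled-back sequences at
  \<open>X\<close>; pulling back does not increase norms, so these sequences stay square
  summable.\<close>

lemma conj_op_continuous:
  assumes A: "A \<subseteq> bop (ell2 P)" and AA: "cj ` A \<subseteq> A'"
  shows "continuous_map (subtopology (weak_star_top (ell2 P)) A) (subtopology (weak_star_top (ell2 P')) A') cj"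
proof -
  let ?T = "subtopology (weak_star_top (ell2 P)) A"
  have "continuous_map ?T (weak_star_top (ell2 P')) cj"
    unfolding weak_star_top_def[of "ell2 P'"]
  proof (rule continuous_on_generated_topo)
    show "cj ` topspace ?T \<subseteq> \<Union> {{S. sigma_weak_fun xs ys S \<in> U} | xs ys U.
        (\<forall>n. xs n \<in> ell2 P' \<and> ys n \<in> ell2 P') \<and>
        (\<lambda>n. (hnorm (xs n))\<^sup>2) summable_on UNIV \<and>
        (\<lambda>n. (hnorm (ys n))\<^sup>2) summable_on UNIV \<and> open U}"
      using topspace_weak_star_top[of P', unfolded weak_star_top_def topology_generated_by_topspace]
      by simp
    fix U assume "U \<in> {{S. sigma_weak_fun xs ys S \<in> U} | xs ys U.
        (\<forall>n. xs n \<in> ell2 P' \<and> ys n \<in> ell2 P') \<and>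
        (\<lambda>n. (hnorm (xs n))\<^sup>2) summable_on UNIV \<and>
        (\<lambda>n. (hnorm (ys n))\<^sup>2) summable_on UNIV \<and> open U}"
    then obtain xs ys U' where U: "U = {S. sigma_weak_fun xs ys S \<in> U'}" "open U'"
      and xs: "\<And>n. xs n \<in> ell2 P'" "(\<lambda>n. (hnorm (xs n))\<^sup>2) summable_on UNIV"
      and ys: "\<And>n. ys n \<in> ell2 P'" "(\<lambda>n. (hnorm (ys n))\<^sup>2) summable_on UNIV"
      by blast
    have sm: "(\<lambda>n. (hnorm (cpull P h (zs n)))\<^sup>2) summable_on UNIV"
      if "\<And>n::nat. zs n \<in> ell2 P'" "(\<lambda>n. (hnorm (zs n))\<^sup>2) summable_on UNIV" for zs
      by (rule summable_on_comparison_test[OF that(2)])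
        (auto intro!: power_mono cpull_bound(2)[OF that(1) inj_h])
    have eq: "sigma_weak_fun xs ys (cj X) = sigma_weak_fun (\<lambda>n. cpull P h (xs n)) (\<lambda>n. cpull P h (ys n)) X"
      if "X \<in> A" for X
      unfolding sigma_weak_fun_def
      using iprod_push[OF bop_in[OF subsetD[OF A that] pull_in[OF xs(1)]]] xs(1)
      by (simp add: conj_op_def)
    have "openin (weak_star_top (ell2 P))
       {S. sigma_weak_fun (\<lambda>n. cpull P h (xs n)) (\<lambda>n. cpull P h (ys n)) S \<in> U'}"
      by (rule openin_weak_star_basis) (use pull_in xs ys sm U in auto)
    moreover have "cj -` U \<inter> topspace ?T =
       {S. sigma_weak_fun (\<lambda>n. cpull P h (xs n)) (\<lambda>n. cpull P h (ys n)) S \<in> U'} \<inter> A"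
      using eq U by auto
    ultimately show "openin ?T (cj -` U \<inter> topspace ?T)"
      by (auto simp: openin_subtopology)
  qed
  then show ?thesis using AA by (auto simp: continuous_map_in_subtopology)
qed

end

section \<open>Relabelling paths along a graph isomorphism\<close>

locale graph_bij = G: graph V E r s + G': graph V' E' r' s'
  for V :: "'v set" and E :: "'e set" and r s :: "'e \<Rightarrow> 'v"
    and V' :: "'w set" and E' :: "'f set" and r' s' :: "'f \<Rightarrow> 'w" +
  fixes \<phi> \<phi>i \<psi> \<psi>i
  assumes \<phi>: "v \<in> V \<Longrightarrow> \<phi> v \<in> V' \<and> \<phi>i (\<phi> v) = v"
    and \<phi>i: "w \<in> V' \<Longrightarrow> \<phi>i w \<in> V \<and> \<phi> (\<phi>i w) = w"
    and \<psi>: "e \<in> E \<Longrightarrow> \<psi> e \<in> E' \<and> \<psi>i (\<psi> e) = e \<and> r' (\<psi> e) = \<phi> (r e) \<and> s' (\<psi> e) = \<phi> (s e)"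
    and \<psi>i: "f \<in> E' \<Longrightarrow> \<psi>i f \<in> E \<and> \<psi> (\<psi>i f) = f"
begin

text \<open>Carrying the inverse maps as locale parameters makes the situation symmetric, so each
  fact about \<open>cj\<close> also serves its inverse.\<close>

lemma inverse_graph_bij: "graph_bij V' E' r' s' V E r s \<phi>i \<phi> \<psi>i \<psi>"
proof
  fix f assume f: "f \<in> E'"
  then have e: "\<psi>i f \<in> E" "\<psi> (\<psi>i f) = f" using \<psi>i by auto
  have "\<phi>i (r' f) = r (\<psi>i f)" "\<phi>i (s' f) = s (\<psi>i f)"
    using \<psi>[OF e(1)] e \<phi>[OF G.range_in_V[OF e(1)]] \<phi>[OF G.source_in_V[OF e(1)]] by metis+
  then show "\<psi>i f \<in> E \<and> \<psi> (\<psi>i f) = f \<and> r (\<psi>i f) = \<phi>i (r' f) \<and> s (\<psi>i f) = \<phi>i (s' f)"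
    using e by simp
qed (use \<phi> \<phi>i \<psi> in auto)

definition "pmap = (\<lambda>(v, es). (\<phi> v, map \<psi> es))"
definition "pmapi = (\<lambda>(v, es). (\<phi>i v, map \<psi>i es))"

lemma path_map: "(v, es) \<in> G.P \<Longrightarrow> (\<phi> v, map \<psi> es) \<in> G'.P \<and>
    \<phi>i (\<phi> v) = v \<and> map \<psi>i (map \<psi> es) = es \<and> vend s' (\<phi> v) (map \<psi> es) = \<phi> (vend s v es)"
proof (induction es arbitrary: v)
  case (Cons e es)
  then have "e \<in> E" "r e = v" "(s e, es) \<in> G.P" by auto
  then show ?case using Cons.IH[of "s e"] \<psi>[of e] \<phi>[OF G.range_in_V, of e] by auto
qed (use \<phi> in auto)

lemma index_bij: "index_bij G.P G'.P pmap pmapi"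
proof -
  interpret inv: graph_bij V' E' r' s' V E r s \<phi>i \<phi> \<psi>i \<psi> by (rule inverse_graph_bij)
  show ?thesis
  proof
    show "pmap p \<in> G'.P" "pmapi (pmap p) = p" if "p \<in> G.P" for p
      using path_map[of "fst p" "snd p"] that by (auto simp: pmap_def pmapi_def case_prod_unfold)
    show "pmapi q \<in> G.P" "pmap (pmapi q) = q" if "q \<in> G'.P" for q
      using inv.path_map[of "fst q" "snd q"] that by (auto simp: pmap_def pmapi_def case_prod_unfold)
  qed
qed

sublocale index_bij G.P G'.P pmap pmapi by (rule index_bij)

lemma pull_xi:
  assumes "u \<in> V"
  shows "cpull G.P pmap (xi (\<phi> u, [])) = xi (u, [])"
proof
  fix p :: "'v \<times> 'e list"
  obtain v es where [simp]: "p = (v, es)" by fastforce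
  show "cpull G.P pmap (xi (\<phi> u, [])) p = xi (u, []) p"
  proof (cases "(v, es) \<in> G.P")
    case True
    then have "\<phi> v = \<phi> u \<longleftrightarrow> v = u" using assms \<phi>[of u] \<phi>[OF G.path_start[OF True]] by metis
    then show ?thesis using True by (simp add: cpull_def xi_apply pmap_def)
  next
    case False
    then have "(v, es) \<noteq> (u, [])" using assms by auto
    then show ?thesis using False by (simp add: cpull_def xi_apply)
  qed
qed

lemma cf_conj:
  assumes p: "(v, es) \<in> G.P"
  shows "G'.cf (cj X) (\<phi> v) (map \<psi> es) = G.cf X v es"
proof -
  note pm = path_map[OF p]
  have u: "vend s v es \<in> V" by (rule G.path_end[OF p])
  then have x: "xi (\<phi> (vend s v es), []) \<in> G'.H" using \<phi> by simp
  have "pmapi (\<phi> v, map \<psi> es) = (v, es)" using pm by (simp add: pmapi_def)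
  then show ?thesis
    unfolding coef_def using pm conj_op_apply[OF x, of "(\<phi> v, map \<psi> es)" X]
    by (simp add: pull_xi[OF u])
qed

text \<open>Relabelling commutes with cutting paths and preserves coefficients, so the convolution
  identity is transported directly, instead of following generators through two closures.\<close>

lemma conj_conv:
  assumes X: "X \<in> G.CO"
  shows "cj X \<in> G'.CO"
proof (rule G'.conv_opsI)
  show "cj X \<in> bop G'.H" by (rule conj_op_bop[OF G.conv_ops_bop[OF X]])
  fix y v' gs' assume y: "y \<in> G'.H" and p': "(v', gs') \<in> G'.P"
  obtain v gs where vg: "pmapi (v', gs') = (v, gs)" by fastforce
  have p: "(v, gs) \<in> G.P" using g_in[OF p'] vg by simp
  have eq: "v' = \<phi> v" "gs' = map \<psi> gs" using hg[OF p'] vg by (auto simp: pmap_def)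
  have "cj X y (v', gs') = X (cpull G.P pmap y) (v, gs)"
    using conj_op_apply[OF y p', of X] vg by simp
  also have "\<dots> = (\<Sum>k\<le>length gs. G.cf X v (take k gs) *
      cpull G.P pmap y (vend s v (take k gs), drop k gs))"
    by (rule G.conv_ops_apply[OF X pull_in[OF y] p])
  also have "\<dots> = (\<Sum>k\<le>length gs'. G'.cf (cj X) v' (take k gs') * y (vend s' v' (take k gs'), drop k gs'))"
  proof (rule sum.cong)
    fix k assume "k \<in> {..length gs'}"
    show "G.cf X v (take k gs) * cpull G.P pmap y (vend s v (take k gs), drop k gs) =
      G'.cf (cj X) v' (take k gs') * y (vend s' v' (take k gs'), drop k gs')"
      using cf_conj[OF G.path_take[OF p, of k], of X] path_map[OF G.path_take[OF p, of k]]
        G.path_drop[OF p, of k]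
      by (simp add: eq take_map drop_map cpull_def pmap_def)
  qed (simp add: eq)
  finally show "cj X y (v', gs') =
    (\<Sum>k\<le>length gs'. G'.cf (cj X) v' (take k gs') * y (vend s' v' (take k gs'), drop k gs'))" .
qed

end

text \<open>Without vertices there are no generators, and \<open>alg_gen\<close> of nothing does not
  even contain zero, so the algebra is the empty set. Empty vertex sets therefore form separate
  cases of the equivalence.\<close>

lemma (in graph) fsga_empty_iff: "fsga V E r s = {} \<longleftrightarrow> V = {}"
proof
  assume "V = {}"
  then have "E = {}" using range_in_V by blast
  have "A \<notin> alg_gen {}" for A :: "('v \<times> 'e list \<Rightarrow> complex) \<Rightarrow> ('v \<times> 'e list \<Rightarrow> complex)"
  proof
    assume "A \<in> alg_gen {}"
    then show False by induction auto
  qed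
  then have "alg_gen (L ` E \<union> Q ` V) = {}" using \<open>V = {}\<close> \<open>E = {}\<close> by auto
  then show "fsga V E r s = {}" by (simp add: fsga_def tensor_alg_def)
qed (use fsga_eq_conv_ops Pop_conv in blast)

theorem theorem3p8:
  fixes V :: "'v set" and E :: "'e set" and r s :: "'e \<Rightarrow> 'v"
    and V' :: "'w set" and E' :: "'f set" and r' s' :: "'f \<Rightarrow> 'w"
  assumes "countable_graph V E r s" and "countable_graph V' E' r' s'"
  shows "(\<exists>\<tau>. alg_iso (fsga V E r s) (fsga V' E' r' s') \<tau> \<and>
            homeomorphic_map (subtopology (weak_star_top (HG V E r s)) (fsga V E r s))
                             (subtopology (weak_star_top (HG V' E' r' s')) (fsga V' E' r' s')) \<tau>)
         \<longleftrightarrow> graph_iso V E r s V' E' r' s'"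
proof -
  interpret G: graph V E r s by unfold_locales (rule assms(1))
  interpret G': graph V' E' r' s' by unfold_locales (rule assms(2))
  let ?T = "subtopology (weak_star_top G.H) G.CO" and ?T' = "subtopology (weak_star_top G'.H) G'.CO"
  consider "V = {}" "V' = {}" | "V = {}" "V' \<noteq> {}" | "V \<noteq> {}" "V' = {}" | "V \<noteq> {}" "V' \<noteq> {}" by blast
  then show ?thesis
  proof cases
    case 1
    then have E: "E = {}" "E' = {}" using G.range_in_V G'.range_in_V by blast+
    have f: "fsga V E r s = {}" "fsga V' E' r' s' = {}" using 1 G.fsga_empty_iff G'.fsga_empty_iff by auto
    have "graph_iso V E r s V' E' r' s'" using 1 E by (simp add: graph_iso_def bij_betw_def)
    moreover have "homeomorphic_map (subtopology (weak_star_top (HG V E r s)) {})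
        (subtopology (weak_star_top (HG V' E' r' s')) {}) (\<lambda>_. undefined)"
      by (simp add: homeomorphic_map_maps homeomorphic_maps_def continuous_map_on_empty)
    ultimately show ?thesis unfolding f by (auto simp: alg_iso_def bij_betw_def)
  next
    case 2
    then have "fsga V E r s = {}" "fsga V' E' r' s' \<noteq> {}" using G.fsga_empty_iff G'.fsga_empty_iff by auto
    then show ?thesis using 2 by (auto simp: alg_iso_def graph_iso_def bij_betw_def)
  next
    case 3
    then have "fsga V E r s \<noteq> {}" "fsga V' E' r' s' = {}" using G.fsga_empty_iff G'.fsga_empty_iff by auto
    then show ?thesis using 3 by (auto simp: alg_iso_def graph_iso_def bij_betw_def)
  next
    case 4
    note eqs = G.fsga_eq_conv_ops[OF 4(1)] G'.fsga_eq_conv_ops[OF 4(2)] HG_def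
    show ?thesis
      unfolding eqs
    proof
      assume "\<exists>\<tau>. alg_iso G.CO G'.CO \<tau> \<and> homeomorphic_map ?T ?T' \<tau>"
      then obtain \<tau> \<sigma> where iso: "alg_iso G.CO G'.CO \<tau>" and hm: "homeomorphic_maps ?T ?T' \<tau> \<sigma>"
        by (auto simp: homeomorphic_map_maps)
      have ct: "continuous_map ?T ?T' \<tau>" "continuous_map ?T' ?T \<sigma>"
        and st: "\<And>X. X \<in> G.CO \<Longrightarrow> \<sigma> (\<tau> X) = X" and ts: "\<And>Y. Y \<in> G'.CO \<Longrightarrow> \<tau> (\<sigma> Y) = Y"
        using hm by (auto simp: homeomorphic_maps_def)
      have t_in: "\<tau> X \<in> G'.CO" if "X \<in> G.CO" for X
        using continuous_map_funspace[OF ct(1)] that by auto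
      have s_in: "\<sigma> Y \<in> G.CO" if "Y \<in> G'.CO" for Y
        using continuous_map_funspace[OF ct(2)] that by auto
      have add: "\<tau> (op_add X Y) = op_add (\<tau> X) (\<tau> Y)" and comp: "\<tau> (X \<circ> Y) = \<tau> X \<circ> \<tau> Y"
        and scale: "\<tau> (op_scale c X) = op_scale c (\<tau> X)" if "X \<in> G.CO" "Y \<in> G.CO" for X Y c
        using iso that unfolding alg_iso_def by blast+
      interpret iso_pair V E r s V' E' r' s' \<sigma> \<tau>
      proof
        show "\<sigma> (op_add X Y) = op_add (\<sigma> X) (\<sigma> Y)" if "X \<in> G'.CO" "Y \<in> G'.CO" for X Y
          using add[OF s_in s_in, OF that] st[OF G.conv_ops_add[OF s_in s_in, OF that]] ts that by metis
        show "\<sigma> (X \<circ> Y) = \<sigma> X \<circ> \<sigma> Y" if "X \<in> G'.CO" "Y \<in> G'.CO" for X Y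
          using comp[OF s_in s_in, OF that] st[OF G.conv_ops_comp[OF s_in s_in, OF that]] ts that by metis
        show "\<sigma> (op_scale c X) = op_scale c (\<sigma> X)" if "X \<in> G'.CO" for X c
          using scale[OF s_in s_in, OF that that] st[OF G.conv_ops_scale[OF s_in, OF that]] ts that by metis
        show "\<exists>X\<in>G'.CO. \<sigma> X = Z" if "Z \<in> G.CO" for Z using st t_in that by blast
        show "\<exists>X\<in>G.CO. \<tau> X = Z" if "Z \<in> G'.CO" for Z using ts s_in that by blast
      qed (use 4 ct st ts t_in s_in add comp scale in auto)
      show "graph_iso V E r s V' E' r' s'" by (rule graph_isoI)
    next
      assume "graph_iso V E r s V' E' r' s'"
      then obtain \<phi> \<psi> where bij: "bij_betw \<phi> V V'" "bij_betw \<psi> E E'"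
        and rs: "\<forall>e\<in>E. r' (\<psi> e) = \<phi> (r e) \<and> s' (\<psi> e) = \<phi> (s e)"
        by (auto simp: graph_iso_def)
      interpret B: graph_bij V E r s V' E' r' s' \<phi> "inv_into V \<phi>" \<psi> "inv_into E \<psi>"
        using bij rs by unfold_locales
          (auto simp: bij_betw_apply bij_betw_inv_into_left bij_betw_inv_into_right
            bij_betw_apply[OF bij_betw_inv_into])
      interpret I: graph_bij V' E' r' s' V E r s "inv_into V \<phi>" \<phi> "inv_into E \<psi>" \<psi>
        by (rule B.inverse_graph_bij)
      have pm: "I.pmap = B.pmapi" "I.pmapi = B.pmap"
        by (simp_all add: I.pmap_def I.pmapi_def B.pmap_def B.pmapi_def)
      have inv: "\<And>X. X \<in> G.CO \<Longrightarrow> I.cj (B.cj X) = X" "\<And>Y. Y \<in> G'.CO \<Longrightarrow> B.cj (I.cj Y) = Y"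
        using B.conj_op_inverse[OF G.conv_ops_bop] I.conj_op_inverse[OF G'.conv_ops_bop]
        by (simp_all add: pm)
      have "bij_betw B.cj G.CO G'.CO"
        by (rule bij_betw_byWitness[where f' = I.cj]) (use inv B.conj_conv I.conj_conv in auto)
      then have "alg_iso G.CO G'.CO B.cj"
        unfolding alg_iso_def
        using B.conj_op_add B.conj_op_scale B.conj_op_comp[OF G.conv_ops_bop G.conv_ops_bop] by blast
      moreover have "homeomorphic_maps ?T ?T' B.cj I.cj"
        unfolding homeomorphic_maps_def
        using B.conj_op_continuous[of G.CO G'.CO] I.conj_op_continuous[of G'.CO G.CO]
          G.conv_ops_bop G'.conv_ops_bop B.conj_conv I.conj_conv inv
        by (auto simp: image_subset_iff subset_iff)
      ultimately show "\<exists>\<tau>. alg_iso G.CO G'.CO \<tau> \<and> homeomorphic_map ?T ?T' \<tau>"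
        by (auto simp: homeomorphic_map_maps)
    qed
  qed
qed

end
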